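(* Let $n$ be a positive integer and let $p,q$ satisfy $0<p,q<+\infty$ and the supercritical condition $$\frac{1}{p+1}+\frac{1}{q+1}<1-\frac{2}{n}.$$ Let $(u,v)$ be a locally bounded non-negative radial solution of the Lane-Emden system $$-\Delta u = v^p,\qquad -\Delta v = u^q,\qquad u\ge 0,\ v\ge 0,\qquad \text{in } \mathbb{R}^n .$$ Then either $u=v\equiv 0$, or there exist constants $C_1,C_2>0$ and $r_0>0$ such that for all $r\ge r_0$ $$C_1 r^{-\frac{2(p+1)}{pq-1}}\le u(r)\le C_2 r^{-\frac{2(p+1)}{pq-1}},\qquad C_1 r^{-\frac{2(q+1)}{pq-1}}\le v(r)\le C_2 r^{-\frac{2(q+1)}{pq-1}} .$$
   Context: Radial means that $u$ and $v$ depend only on $r=|x|$, $x\in\mathbb{R}^n$; one writes $u(r),v(r)$ for $u(x),v(x)$ with $|x|=r$. Standing assumption: $pq>1$ (this is also implied by the supercritical condition). *)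

theory Defs
  imports "HOL-Analysis.Analysis"
begin

definition partial_derivative ::
  "'a::euclidean_space \<Rightarrow> ('a \<Rightarrow> real) \<Rightarrow> 'a \<Rightarrow> real" where
  "partial_derivative b f x = frechet_derivative f (at x) b"

primrec continuously_differentiable ::
  "nat \<Rightarrow> ('a::euclidean_space \<Rightarrow> real) \<Rightarrow> bool" where
  "continuously_differentiable 0 f \<longleftrightarrow> continuous_on UNIV f"
| "continuously_differentiable (Suc k) f \<longleftrightarrow>
     (\<forall>x. f differentiable (at x)) \<and>
     (\<forall>b\<in>Basis. continuously_differentiable k (partial_derivative b f))"

definition laplacian :: "('a::euclidean_space \<Rightarrow> real) \<Rightarrow> 'a \<Rightarrow> real" where
  "laplacian f x = (\<Sum>b\<in>Basis. partial_derivative b (partial_derivative b f) x)"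

definition test_function :: "('a::euclidean_space \<Rightarrow> real) \<Rightarrow> bool" where
  "test_function \<phi> \<longleftrightarrow>
     (\<forall>k. continuously_differentiable k \<phi>) \<and> compact (closure {x. \<phi> x \<noteq> 0})"

definition locally_bounded :: "('a::euclidean_space \<Rightarrow> real) \<Rightarrow> bool" where
  "locally_bounded f \<longleftrightarrow> (\<forall>K. compact K \<longrightarrow> bounded (f ` K))"

definition radial :: "('a::euclidean_space \<Rightarrow> real) \<Rightarrow> bool" where
  "radial f \<longleftrightarrow> (\<forall>x y. norm x = norm y \<longrightarrow> f x = f y)"

text \<open>
  The equation \<open>-\<Delta>w = f\<close> in the sense of distributions on the whole space.  It is meant for
  Borel functions \<open>w\<close>, \<open>f\<close> that are bounded on compact sets; both integrands are then integrable,
  and no differentiability of \<open>w\<close> is presupposed.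
\<close>

definition neg_laplacian_eq ::
  "('a::euclidean_space \<Rightarrow> real) \<Rightarrow> ('a \<Rightarrow> real) \<Rightarrow> bool" where
  "neg_laplacian_eq w f \<longleftrightarrow>
     (\<forall>\<phi>. test_function \<phi> \<longrightarrow>
        - (\<integral>x. w x * laplacian \<phi> x \<partial>lborel) = (\<integral>x. f x * \<phi> x \<partial>lborel))"

text \<open>
  Locally bounded non-negative solutions.  Without local boundedness, the distributional
  formulation would also admit the singular power solutions
  \<open>a |x|\<^sup>-\<^sup>\<alpha>\<close>, \<open>b |x|\<^sup>-\<^sup>\<beta>\<close> of the supercritical range.
\<close>

definition locally_bounded_lane_emden_solution ::
  "real \<Rightarrow> real \<Rightarrow> ('a::euclidean_space \<Rightarrow> real) \<Rightarrow> ('a \<Rightarrow> real) \<Rightarrow> bool" where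
  "locally_bounded_lane_emden_solution p q u v \<longleftrightarrow>
     u \<in> borel_measurable borel \<and> v \<in> borel_measurable borel \<and>
     locally_bounded u \<and> locally_bounded v \<and>
     (\<forall>x. 0 \<le> u x) \<and> (\<forall>x. 0 \<le> v x) \<and>
     neg_laplacian_eq u (\<lambda>x. v x powr p) \<and>
     neg_laplacian_eq v (\<lambda>x. u x powr q)"

text \<open>
  \<open>U\<close> is the function of \<open>r = |x|\<close> that is written \<open>u(r)\<close>.  A distributional solution is
  determined only up to null sets, so pointwise statements concern its continuous representative,
  which is unique; if \<open>u\<close> itself is continuous, then \<open>u x = U (norm x)\<close> at every \<open>x\<close>.
\<close>

definition radial_profile :: "('a::euclidean_space \<Rightarrow> real) \<Rightarrow> (real \<Rightarrow> real) \<Rightarrow> bool" where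
  "radial_profile u U \<longleftrightarrow>
     continuous_on {0..} U \<and> (AE x in lborel. u x = U (norm x))"

end

theory Submission
  imports Defs
begin

text \<open>
  In polar coordinates, testing with functions of \<open>|x|\<^sup>2\<close> shows that the profiles satisfy
  \<open>U' = - r powr (1 - n) \<integral>\<^sub>0\<^sup>r t powr (n - 1) V\<^sup>p dt\<close> and symmetrically for \<open>V\<close>. Both profiles are
  positive for \<open>r > 0\<close> unless both vanish.

  Put \<open>m = n - 2\<close>, \<open>P = - r U' / U\<close>, \<open>Q = - r V' / V\<close>, \<open>lam = r\<^sup>2 V\<^sup>p / U\<close>, \<open>mu = r\<^sup>2 U\<^sup>q / V\<close>. These solve an
  autonomous quadratic system in \<open>ln r\<close> and
  \<open>lam mu\<^sup>p = r powr (2 (p + 1)) U powr (p q - 1)\<close>, so everything follows once \<open>lam\<close> and \<open>mu\<close> are bounded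
  above and below. The upper bounds are a Harnack type estimate \<open>c lam \<le> m - P\<close>. For the lower
  bounds, the Pohozaev identity gives a quantity \<open>K \<ge> 0\<close> with \<open>r K' = K (P + Q - m) + gap P Q\<close>,
  where \<open>gap > 0\<close> is the supercriticality gap. This keeps \<open>P\<close> and \<open>Q\<close> away from the fast decay rate \<open>m\<close>;
  then \<open>lam\<close> grows whenever \<open>mu\<close> is small and vice versa.
\<close>

subsection \<open>Smooth cut-off functions\<close>

text \<open>The solutions are only measurable and locally bounded, so no ODE is available at the
  start. The radial test functions are generated by weights \<open>\<xi>\<close> of mean zero, and
  this is what gives them compact support. The weak equation therefore leaves one constant free:
  profile plus integrated source is orthogonal to all mean-zero weights, hence constant almost
  everywhere. The continuous representatives read off from this identity satisfy a closed pointwise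
  system, because the sources enter only under integrals. The exponents may lie below 1, where
  \<open>V powr p\<close> is not Lipschitz at 0; positivity is therefore drawn from strict
  monotonicity and not from uniqueness for the ODE. What must be excluded is fast decay,
  \<open>P\<close> close to \<open>m\<close>, which forces \<open>lam\<close> to be small. Each
  lower bound is a regime argument: inside the bad regime some combination of a logarithm with
  bounded quantities is monotone, and it is followed back to \<open>r = 1\<close> or to the last
  entry into the regime, where an explicit bound holds. The system is invariant under exchanging
  \<open>U\<close>, \<open>p\<close> with \<open>V\<close>, \<open>q\<close>, so each estimate is
  proved for one component only.\<close>

lemma partial_derivative_eq:
  assumes "(f has_derivative f') (at x)"
  shows "partial_derivative b f x = f' b"
  using frechet_derivative_at[OF assms] by (simp add: partial_derivative_def)

lemma continuously_differentiable_SucI: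
  fixes f :: "'a::euclidean_space \<Rightarrow> real"
  assumes "\<And>x. (f has_derivative f' x) (at x)"
    and "\<And>b. b \<in> Basis \<Longrightarrow> continuously_differentiable k (\<lambda>x. f' x b)"
  shows "continuously_differentiable (Suc k) f"
proof -
  have "partial_derivative b f = (\<lambda>x. f' x b)" for b
    using partial_derivative_eq[OF assms(1)] by auto
  then show ?thesis using assms by (auto simp: differentiable_def)
qed

lemma continuously_differentiable_SucD:
  assumes "continuously_differentiable (Suc k) f"
  shows "(f has_derivative (\<lambda>h. frechet_derivative f (at x) h)) (at x)"
    and "b \<in> Basis \<Longrightarrow> continuously_differentiable k (\<lambda>x. frechet_derivative f (at x) b)"
  using assms by (auto simp: frechet_derivative_works[symmetric] partial_derivative_def[abs_def])

lemma continuously_differentiable_imp_continuous: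
  "continuously_differentiable k f \<Longrightarrow> continuous_on UNIV f"
  by (cases k) (simp_all add: differentiable_imp_continuous_within continuous_at_imp_continuous_on)

lemma continuously_differentiable_lower:
  fixes f :: "'a::euclidean_space \<Rightarrow> real"
  shows "continuously_differentiable (Suc k) f \<Longrightarrow> continuously_differentiable k f"
proof (induction k arbitrary: f)
  case 0
  then show ?case unfolding continuously_differentiable.simps(1)
    by (rule continuously_differentiable_imp_continuous)
next
  case (Suc k)
  show ?case
    unfolding continuously_differentiable.simps(2)[of k f]
  proof (intro conjI ballI)
    fix b :: 'a assume "b \<in> Basis"
    then have "continuously_differentiable (Suc k) (partial_derivative b f)"
      using Suc.prems unfolding continuously_differentiable.simps(2)[of "Suc k" f] by blast
    then show "continuously_differentiable k (partial_derivative b f)" by (rule Suc.IH)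
  qed (use Suc.prems in simp)
qed

lemma continuously_differentiable_const: "continuously_differentiable k (\<lambda>_. c)"
proof (induction k arbitrary: c)
  case (Suc k)
  show ?case by (rule continuously_differentiable_SucI[where f' = "\<lambda>_ _. 0"]) (auto intro: Suc)
qed auto

lemma continuously_differentiable_add:
  "continuously_differentiable k f \<Longrightarrow> continuously_differentiable k g \<Longrightarrow>
   continuously_differentiable k (\<lambda>x. f x + g x)"
proof (induction k arbitrary: f g)
  case (Suc k)
  note f = continuously_differentiable_SucD[OF Suc.prems(1)]
    and g = continuously_differentiable_SucD[OF Suc.prems(2)]
  show ?case
    by (rule continuously_differentiable_SucI[OF has_derivative_add[OF f(1) g(1)]]) (intro Suc.IH f g)
qed (auto intro!: continuous_intros)

lemma continuously_differentiable_mult: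
  "continuously_differentiable k f \<Longrightarrow> continuously_differentiable k g \<Longrightarrow>
   continuously_differentiable k (\<lambda>x. f x * g x)"
proof (induction k arbitrary: f g)
  case (Suc k)
  note f = continuously_differentiable_SucD[OF Suc.prems(1)]
    and g = continuously_differentiable_SucD[OF Suc.prems(2)]
  show ?case
    by (rule continuously_differentiable_SucI[OF has_derivative_mult[OF f(1) g(1)]])
      (intro continuously_differentiable_add Suc.IH f g Suc.prems[THEN continuously_differentiable_lower])
qed (auto intro!: continuous_intros)

lemma continuously_differentiable_inner: "continuously_differentiable k (\<lambda>x. x \<bullet> b)"
proof (cases k)
  case (Suc j)
  show ?thesis unfolding Suc
    by (rule continuously_differentiable_SucI[where f' = "\<lambda>_ h. h \<bullet> b"])
      (auto intro!: derivative_eq_intros continuously_differentiable_const)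
qed (auto intro!: continuous_intros)

lemma continuously_differentiable_ident: "continuously_differentiable k (\<lambda>x::real. x)"
  using continuously_differentiable_inner[of k "1::real"] by simp

lemma continuously_differentiable_inner_self:
  "continuously_differentiable k (\<lambda>x::'a::euclidean_space. x \<bullet> x)"
proof (cases k)
  case (Suc j)
  have "continuously_differentiable j (\<lambda>x. 2 * (x \<bullet> b))" for b :: 'a
    by (intro continuously_differentiable_mult continuously_differentiable_const continuously_differentiable_inner)
  then show ?thesis unfolding Suc
    by (intro continuously_differentiable_SucI[where f' = "\<lambda>x h. 2 * (x \<bullet> h)"])
      (auto intro!: derivative_eq_intros simp: inner_commute)
qed (auto intro!: continuous_intros)

lemma continuously_differentiable_realI:
  assumes "\<And>x. (f has_real_derivative f' x) (at x)" "continuously_differentiable k f'"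
  shows "continuously_differentiable (Suc k) f"
  by (rule continuously_differentiable_SucI[where f' = "\<lambda>x h. f' x * h"])
    (use assms in \<open>auto simp: has_field_derivative_def\<close>)

lemma continuously_differentiable_realD:
  fixes f :: "real \<Rightarrow> real"
  assumes "continuously_differentiable (Suc k) f"
  shows "(f has_real_derivative partial_derivative 1 f x) (at x)"
    and "continuously_differentiable k (partial_derivative 1 f)"
proof -
  interpret linear "frechet_derivative f (at x)"
    using assms by (intro linear_frechet_derivative) simp
  have eq: "frechet_derivative f (at x) = (\<lambda>h. partial_derivative 1 f x * h)"
  proof
    fix h
    show "frechet_derivative f (at x) h = partial_derivative 1 f x * h"
      unfolding partial_derivative_def
      using scale[of h 1] by (metis mult.commute mult.right_neutral real_scaleR_def)
  qed
  then show "(f has_real_derivative partial_derivative 1 f x) (at x)"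
    using continuously_differentiable_SucD(1)[OF assms, of x] by (simp add: has_field_derivative_def eq)
qed (use assms in simp)

lemma continuously_differentiable_compose:
  fixes f :: "real \<Rightarrow> real"
  shows "continuously_differentiable k f \<Longrightarrow> continuously_differentiable k g \<Longrightarrow>
   continuously_differentiable k (\<lambda>x. f (g x))"
proof (induction k arbitrary: f g)
  case (Suc k)
  note f' = continuously_differentiable_realD[OF Suc.prems(1)]
  note g = continuously_differentiable_SucD[OF Suc.prems(2)]
  show ?case
    by (rule continuously_differentiable_SucI[OF
          has_derivative_compose[OF g(1) f'(1)[unfolded has_field_derivative_def]]])
      (rule continuously_differentiable_mult[OF Suc.IH[OF f'(2) continuously_differentiable_lower[OF Suc.prems(2)]] g(2)])
qed (simp, rule continuous_on_compose2[of UNIV], auto)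

lemma DERIV_zero_of_vanishing:
  fixes f :: "real \<Rightarrow> real"
  assumes "\<And>y. y < a \<Longrightarrow> f y = 0" "x < a"
  shows "(f has_real_derivative 0) (at x)"
  by (rule has_field_derivative_transform_within_open[of "\<lambda>_. 0" 0 x "{..<a}"]) (use assms in auto)

text \<open>The only singularity of \<open>x powr c\<close> lies at 0, where \<open>f\<close>
  vanishes identically. The derivative is a sum of two products of the same kind, with factors
  \<open>f'\<close> and \<open>c * f\<close> that again vanish up to \<open>a\<close>, so the
  induction must range over all \<open>f\<close> and \<open>c\<close>.\<close>

lemma continuously_differentiable_cutoff_powr:
  assumes "0 < a"
  shows "\<forall>j. continuously_differentiable j f \<Longrightarrow> \<forall>x\<le>a. f x = 0 \<Longrightarrow>
    continuously_differentiable k (\<lambda>x::real. f x * x powr c)"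
proof (induction k arbitrary: f c)
  case 0
  have "isCont (\<lambda>x. f x * x powr c) x" for x
  proof (cases "x < a")
    case True
    show ?thesis
      by (rule DERIV_isCont[OF DERIV_zero_of_vanishing[OF _ True]]) (use 0(2) in simp)
  next
    case False
    then have "0 < x" using assms by simp
    moreover have "isCont f x"
      using 0(1)[THEN spec, of 0] by (simp add: continuous_on_eq_continuous_at)
    ultimately show ?thesis by (intro continuous_intros) auto
  qed
  then show ?case by (simp add: continuous_on_eq_continuous_at)
next
  case (Suc k)
  define f' where "f' = partial_derivative 1 f"
  have Df: "(f has_real_derivative f' x) (at x)" for x
    unfolding f'_def using Suc.prems(1) by (intro continuously_differentiable_realD[of 0]) blast
  have f': "\<forall>j. continuously_differentiable j f'" unfolding f'_def
    using Suc.prems(1) by (intro allI continuously_differentiable_realD(2)) simp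
  have f'0: "f' x = 0" if "x < a" for x
    using DERIV_unique[OF Df DERIV_zero_of_vanishing[OF _ that]] Suc.prems(2) by simp
  have f'0: "\<forall>x\<le>a. f' x = 0"
  proof (intro allI impI)
    fix x assume "x \<le> a"
    \<comment> \<open>At the end point itself \<open>f\<close> is known only on one side; continuity
      of \<open>f'\<close> carries the value 0 over from the left.\<close>
    moreover have "f' a = 0"
    proof (rule tendsto_unique)
      show "(f' \<longlongrightarrow> f' a) (at_left a)"
        using f'[THEN spec, of 0] filterlim_at_split
        by (fastforce simp: continuous_on_eq_continuous_at isCont_def)
      show "(f' \<longlongrightarrow> 0) (at_left a)"
        by (rule tendsto_eventually) (auto intro!: eventually_at_leftI[of "a - 1"] simp: f'0)
    qed simp
    ultimately show "f' x = 0" using f'0 by (cases "x = a") auto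
  qed
  show ?case
  proof (rule continuously_differentiable_realI)
    show "((\<lambda>x. f x * x powr c) has_real_derivative f' x * x powr c + (c * f x) * x powr (c - 1)) (at x)" for x
    proof (cases "x < a")
      case True
      have "((\<lambda>x. f x * x powr c) has_real_derivative 0) (at x)"
        by (rule DERIV_zero_of_vanishing[OF _ True]) (use Suc.prems(2) in simp)
      then show ?thesis using Suc.prems(2) f'0 True by simp
    next
      case False
      then have "0 < x" using assms by simp
      show ?thesis
        by (rule DERIV_cong[OF DERIV_mult[OF Df has_real_derivative_powr[OF \<open>0 < x\<close>]]]) simp
    qed
    show "continuously_differentiable k (\<lambda>x. f' x * x powr c + (c * f x) * x powr (c - 1))"
      using f' f'0 Suc.prems
      by (intro continuously_differentiable_add Suc.IH)
        (auto intro!: continuously_differentiable_mult continuously_differentiable_const)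
  qed
qed

section \<open>Flat functions and bumps\<close>

definition flat_exp :: "real poly \<Rightarrow> real \<Rightarrow> real" where
  "flat_exp P x = (if x \<le> 0 then 0 else poly P (1 / x) * exp (- (1 / x)))"

lemma flat_exp_tendsto: "(flat_exp P \<longlongrightarrow> 0) (at_right 0)"
proof -
  have "((\<lambda>y. \<Sum>i\<le>degree P. coeff P i * (y ^ i / exp y)) \<longlongrightarrow> 0) at_top"
    by (intro tendsto_null_sum tendsto_mult_right_zero tendsto_power_div_exp_0)
  then have "((\<lambda>x. \<Sum>i\<le>degree P. coeff P i * ((inverse x) ^ i / exp (inverse x))) \<longlongrightarrow> 0) (at_right 0)"
    by (rule filterlim_compose[OF _ filterlim_inverse_at_top_right])
  moreover have "eventually (\<lambda>x. (\<Sum>i\<le>degree P. coeff P i * ((inverse x) ^ i / exp (inverse x))) = flat_exp P x) (at_right 0)"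
    by (rule eventually_at_rightI[of 0 1])
      (auto simp: flat_exp_def poly_altdef sum_distrib_right exp_minus divide_inverse mult.assoc intro!: sum.cong)
  ultimately show ?thesis by (rule Lim_transform_eventually)
qed

text \<open>With \<open>y = 1 / x\<close> one has \<open>d/dx = - y\<^sup>2 d/dy\<close>, and
  applying this to \<open>P(y) exp (- y)\<close> gives \<open>y\<^sup>2 (P - P') exp (- y)\<close>.
  Carrying a polynomial factor makes the family closed under differentiation, so that smoothness
  becomes an induction.\<close>

lemma DERIV_flat_exp:
  "(flat_exp P has_real_derivative flat_exp (monom 1 2 * (P - pderiv P)) x) (at x)"
proof -
  consider "x < 0" | "x = 0" | "0 < x" by linarith
  then show ?thesis
  proof cases
    case 1
    have "(flat_exp P has_real_derivative 0) (at x)"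
      by (rule has_field_derivative_transform_within_open[of "\<lambda>_. 0" 0 x "{..<0}"])
        (use 1 in \<open>auto simp: flat_exp_def\<close>)
    then show ?thesis using 1 by (simp add: flat_exp_def)
  next
    case 2
    have "((\<lambda>h. (flat_exp P (0 + h) - flat_exp P 0) / h) \<longlongrightarrow> 0) (at 0)"
    proof (rule filterlim_split_at)
      show "((\<lambda>h. (flat_exp P (0 + h) - flat_exp P 0) / h) \<longlongrightarrow> 0) (at_left 0)"
        by (rule tendsto_eventually) (auto intro!: eventually_at_leftI[of "-1"] simp: flat_exp_def)
      \<comment> \<open>Dividing by \<open>h\<close> multiplies the polynomial in
        \<open>1 / h\<close> by its variable, so the difference quotient at 0 is again a flat
        function.\<close>
      have "eventually (\<lambda>h. flat_exp ([:0, 1:] * P) h = (flat_exp P (0 + h) - flat_exp P 0) / h) (at_right 0)"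
        by (rule eventually_at_rightI[of 0 1]) (auto simp: flat_exp_def)
      then show "((\<lambda>h. (flat_exp P (0 + h) - flat_exp P 0) / h) \<longlongrightarrow> 0) (at_right 0)"
        using flat_exp_tendsto by (rule Lim_transform_eventually[rotated])
    qed
    then show ?thesis using 2 by (simp add: DERIV_def flat_exp_def)
  next
    case 3
    have "((\<lambda>x. poly P (1 / x) * exp (- (1 / x))) has_real_derivative
        flat_exp (monom 1 2 * (P - pderiv P)) x) (at x)"
      using 3 by (auto intro!: derivative_eq_intros DERIV_chain'[OF _ poly_DERIV]
          simp: flat_exp_def poly_monom power2_eq_square algebra_simps divide_inverse)
    then show ?thesis
      by (rule has_field_derivative_transform_within_open[of _ _ _ "{0<..}"])
        (use 3 in \<open>auto simp: flat_exp_def\<close>)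
  qed
qed

lemma continuously_differentiable_flat_exp: "continuously_differentiable k (flat_exp P)"
proof (induction k arbitrary: P)
  case 0
  then show ?case using DERIV_isCont[OF DERIV_flat_exp] by (auto simp: continuous_on_eq_continuous_at)
next
  case (Suc k)
  show ?case by (rule continuously_differentiable_realI[OF DERIV_flat_exp Suc])
qed

text \<open>The parameter \<open>k\<close> is a steepness: as it grows, the bump tends pointwise to
  the indicator of the open interval while staying below 1 and vanishing outside. Dominated
  convergence then applies.\<close>

definition bump :: "real \<Rightarrow> real \<Rightarrow> nat \<Rightarrow> real \<Rightarrow> real" where
  "bump a b k x = flat_exp 1 (real k * (x - a)) * flat_exp 1 (real k * (b - x))"

lemma continuously_differentiable_bump: "continuously_differentiable j (bump a b k)"
proof -
  have eq: "bump a b k = (\<lambda>x. flat_exp 1 (real k * (x + - a)) * flat_exp 1 (real k * (b + - 1 * x)))"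
    by (auto simp: bump_def)
  show ?thesis
    unfolding eq
    by (intro continuously_differentiable_mult continuously_differentiable_compose[OF continuously_differentiable_flat_exp]
      continuously_differentiable_add continuously_differentiable_const continuously_differentiable_ident)
qed

lemma bump_range: "0 \<le> bump a b k x" "bump a b k x \<le> 1"
  by (auto simp: bump_def flat_exp_def intro!: mult_le_one)

lemma bump_outside: "x \<notin> {a<..<b} \<Longrightarrow> bump a b k x = 0"
  by (auto simp: bump_def flat_exp_def mult_nonneg_nonpos)

lemma bump_tendsto: "(\<lambda>k. bump a b k x) \<longlonglongrightarrow> indicator {a<..<b} x"
proof (cases "x \<in> {a<..<b}")
  case True
  have "(\<lambda>k. flat_exp 1 (real k * y)) \<longlonglongrightarrow> 1" if "0 < y" for y
  proof -
    have "(\<lambda>k. exp (- (inverse y * inverse (real k)))) \<longlonglongrightarrow> exp (- (inverse y * 0))"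
      by (intro tendsto_intros lim_inverse_n)
    moreover have "eventually (\<lambda>k. exp (- (inverse y * inverse (real k))) = flat_exp 1 (real k * y)) sequentially"
      using that
      by (intro eventually_mono[OF eventually_gt_at_top[of 0]])
        (auto simp: flat_exp_def divide_inverse mult_le_0_iff mult.commute)
    ultimately show ?thesis using Lim_transform_eventually by fastforce
  qed
  from tendsto_mult[OF this this, of "x - a" "b - x"] True show ?thesis by (simp add: bump_def)
qed (simp add: bump_outside)

subsection \<open>Measurable functions of the radius\<close>

text \<open>The factor \<open>n * unit_ball_vol n\<close> is the area of the unit sphere, so this is
  the area of the sphere of radius \<open>r\<close>.\<close>

definition radial_density :: "nat \<Rightarrow> real \<Rightarrow> real" where
  "radial_density n r = (real n * unit_ball_vol n) * r ^ (n - 1) * indicator {0..} r"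

lemma radial_density_nonneg: "0 \<le> radial_density n r"
  by (auto simp: radial_density_def indicator_def)

lemma measurable_radial_density [measurable]: "radial_density n \<in> borel_measurable borel"
  unfolding radial_density_def by measurable

text \<open>Polar coordinates for radial integrands need no angular part: the image of Lebesgue
  measure under the norm is determined by the volumes of balls, that is, by its values on the
  half-lines \<open>{..x}\<close>.\<close>

lemma distr_norm_lborel:
  "distr (lborel :: 'a::euclidean_space measure) borel norm = density lborel (radial_density DIM('a))"
proof (rule measure_eqI_generator_eq[where E = "range (\<lambda>x::real. {..x})" and \<Omega> = UNIV and A = "\<lambda>i. {..real i}"])
  show "Int_stable (range (\<lambda>x::real. {..x}))"
    by (auto simp: Int_stable_def)
  show eq: "emeasure (distr (lborel :: 'a measure) borel norm) X = emeasure (density lborel (radial_density DIM('a))) X"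
    if "X \<in> range (\<lambda>x::real. {..x})" for X
  proof -
    obtain x where X: "X = {..x}" using \<open>X \<in> _\<close> by blast
    let ?n = "DIM('a)"
    have l: "emeasure (distr (lborel :: 'a measure) borel norm) X = emeasure lborel (cball (0::'a) x)"
    proof -
      have "norm -` {..x} \<inter> space (lborel :: 'a measure) = cball 0 x" by auto
      then show ?thesis unfolding X by (subst emeasure_distr) auto
    qed
    have r: "emeasure (density lborel (radial_density ?n)) X
      = (\<integral>\<^sup>+r. ennreal (radial_density ?n r) * indicator {..x} r \<partial>lborel)"
      unfolding X by (subst emeasure_density) auto
    show ?thesis
    proof (cases "0 \<le> x")
      case True
      have "(\<integral>\<^sup>+r. ennreal (radial_density ?n r) * indicator {..x} r \<partial>lborel)
        = (\<integral>\<^sup>+r. ennreal (real ?n * unit_ball_vol ?n * r ^ (?n - 1)) * indicator {0..x} r \<partial>lborel)"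
        by (rule nn_integral_cong) (auto simp: radial_density_def indicator_def)
      also have "\<dots> = ennreal (unit_ball_vol ?n * x ^ ?n - unit_ball_vol ?n * 0 ^ ?n)"
        by (rule nn_integral_FTC_Icc) (use True in \<open>auto intro!: derivative_eq_intros\<close>)
      finally show ?thesis using True unfolding l r by (simp add: emeasure_cball)
    next
      case False
      then have "(\<integral>\<^sup>+r. ennreal (radial_density ?n r) * indicator {..x} r \<partial>lborel) = (\<integral>\<^sup>+r. 0 \<partial>(lborel::real measure))"
        by (intro nn_integral_cong) (auto simp: radial_density_def indicator_def)
      then show ?thesis using False unfolding l r by simp
    qed
  qed
  have "emeasure (distr (lborel :: 'a measure) borel norm) {..real i} = emeasure lborel (cball (0::'a) (real i))" for i
  proof -
    have "norm -` {..real i} \<inter> space (lborel :: 'a measure) = cball 0 (real i)" by auto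
    then show ?thesis by (subst emeasure_distr) auto
  qed
  then show "emeasure (distr (lborel :: 'a measure) borel norm) {..real i} \<noteq> \<infinity>" for i
    by (simp add: emeasure_cball)
  show "(\<Union>i. {..real i}) = UNIV" using real_arch_simple by auto
qed (auto simp: borel_eq_atMost)

lemma integral_radial:
  fixes g :: "real \<Rightarrow> real"
  assumes [measurable]: "g \<in> borel_measurable borel"
  shows "(\<integral>x. g (norm (x::'a::euclidean_space)) \<partial>lborel) = (\<integral>r. radial_density DIM('a) r * g r \<partial>lborel)"
proof -
  have "(\<integral>x. g (norm (x::'a)) \<partial>lborel) = (\<integral>r. g r \<partial>distr (lborel :: 'a measure) borel norm)"
    by (subst integral_distr) auto
  also have "\<dots> = (\<integral>r. radial_density DIM('a) r * g r \<partial>lborel)"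
    unfolding distr_norm_lborel by (subst integral_density) (auto simp: radial_density_nonneg)
  finally show ?thesis .
qed

text \<open>The density is positive for every \<open>r > 0\<close>, and the point 0 is a null set,
  so exceptional radii form a null set in space.\<close>

lemma AE_radial:
  assumes "AE r in lborel. 0 < r \<longrightarrow> P r" and [measurable]: "Measurable.pred borel P"
  shows "AE x::'a::euclidean_space in lborel. P (norm x)"
proof -
  have "AE r in lborel. 0 < ennreal (radial_density DIM('a) r) \<longrightarrow> P r"
    using assms(1) AE_lborel_singleton[of "0::real"]
    by eventually_elim (auto simp: radial_density_def indicator_def split: if_splits)
  then have "AE r in density lborel (radial_density DIM('a)). P r" by (subst AE_density) auto
  then have "AE r in distr (lborel :: 'a measure) borel norm. P r" unfolding distr_norm_lborel .
  then show ?thesis by (subst (asm) AE_distr_iff) auto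
qed

section \<open>Locally bounded measurable functions on the line\<close>

lemma locally_bounded_real_iff:
  fixes f :: "real \<Rightarrow> real"
  shows "locally_bounded f \<longleftrightarrow> (\<forall>B. \<exists>M. \<forall>t. \<bar>t\<bar> \<le> B \<longrightarrow> \<bar>f t\<bar> \<le> M)"
proof
  assume f: "locally_bounded f"
  show "\<forall>B. \<exists>M. \<forall>t. \<bar>t\<bar> \<le> B \<longrightarrow> \<bar>f t\<bar> \<le> M"
  proof
    fix B :: real
    have "bounded (f ` cball 0 B)" using f by (simp add: locally_bounded_def)
    then obtain M where "\<forall>t\<in>cball 0 B. \<bar>f t\<bar> \<le> M" by (auto simp: bounded_iff)
    then show "\<exists>M. \<forall>t. \<bar>t\<bar> \<le> B \<longrightarrow> \<bar>f t\<bar> \<le> M" by (intro exI[of _ M]) simp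
  qed
next
  assume f: "\<forall>B. \<exists>M. \<forall>t. \<bar>t\<bar> \<le> B \<longrightarrow> \<bar>f t\<bar> \<le> M"
  show "locally_bounded f" unfolding locally_bounded_def
  proof (intro allI impI)
    fix K :: "real set" assume "compact K"
    then have "bounded K" by (rule compact_imp_bounded)
    then obtain B where B: "\<And>t. t \<in> K \<Longrightarrow> \<bar>t\<bar> \<le> B" unfolding bounded_iff real_norm_def by blast
    obtain M where "\<And>t. \<bar>t\<bar> \<le> B \<Longrightarrow> \<bar>f t\<bar> \<le> M" using f by blast
    then show "bounded (f ` K)" using B by (intro boundedI[of _ M]) auto
  qed
qed

lemma locally_boundedE:
  fixes f :: "real \<Rightarrow> real"
  assumes "locally_bounded f"
  obtains M where "0 \<le> M" "\<And>t. \<bar>t\<bar> \<le> B \<Longrightarrow> \<bar>f t\<bar> \<le> M"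
proof -
  obtain M where M: "\<forall>t. \<bar>t\<bar> \<le> B \<longrightarrow> \<bar>f t\<bar> \<le> M" using assms unfolding locally_bounded_real_iff by blast
  show ?thesis by (rule that[of "max M 0"]) (use M in \<open>auto simp: le_max_iff_disj\<close>)
qed

lemma locally_bounded_mult:
  fixes f g :: "real \<Rightarrow> real"
  shows "locally_bounded f \<Longrightarrow> locally_bounded g \<Longrightarrow> locally_bounded (\<lambda>x. f x * g x)"
  unfolding locally_bounded_real_iff
proof
  fix B assume f: "\<forall>B. \<exists>M. \<forall>t. \<bar>t\<bar> \<le> B \<longrightarrow> \<bar>f t\<bar> \<le> M" and g: "\<forall>B. \<exists>M. \<forall>t. \<bar>t\<bar> \<le> B \<longrightarrow> \<bar>g t\<bar> \<le> M"
  obtain M N where "\<forall>t. \<bar>t\<bar> \<le> B \<longrightarrow> \<bar>f t\<bar> \<le> M" "\<forall>t. \<bar>t\<bar> \<le> B \<longrightarrow> \<bar>g t\<bar> \<le> N" using f g by meson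
  then show "\<exists>M. \<forall>t. \<bar>t\<bar> \<le> B \<longrightarrow> \<bar>f t * g t\<bar> \<le> M"
    by (intro exI[of _ "M * N"]) (force simp: abs_mult intro!: mult_mono)
qed

lemma locally_bounded_add:
  fixes f g :: "real \<Rightarrow> real"
  shows "locally_bounded f \<Longrightarrow> locally_bounded g \<Longrightarrow> locally_bounded (\<lambda>x. f x + g x)"
  unfolding locally_bounded_real_iff
proof
  fix B assume f: "\<forall>B. \<exists>M. \<forall>t. \<bar>t\<bar> \<le> B \<longrightarrow> \<bar>f t\<bar> \<le> M" and g: "\<forall>B. \<exists>M. \<forall>t. \<bar>t\<bar> \<le> B \<longrightarrow> \<bar>g t\<bar> \<le> M"
  obtain M N where "\<forall>t. \<bar>t\<bar> \<le> B \<longrightarrow> \<bar>f t\<bar> \<le> M" "\<forall>t. \<bar>t\<bar> \<le> B \<longrightarrow> \<bar>g t\<bar> \<le> N" using f g by meson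
  then show "\<exists>M. \<forall>t. \<bar>t\<bar> \<le> B \<longrightarrow> \<bar>f t + g t\<bar> \<le> M"
    by (intro exI[of _ "M + N"]) (force intro: order.trans[OF abs_triangle_ineq])
qed

lemma locally_bounded_continuous:
  "continuous_on UNIV f \<Longrightarrow> locally_bounded f"
  unfolding locally_bounded_def
  by (auto intro!: compact_imp_bounded compact_continuous_image intro: continuous_on_subset)

lemma set_integrable_locally_bounded:
  fixes f :: "real \<Rightarrow> real"
  assumes [measurable]: "f \<in> borel_measurable borel" "S \<in> sets borel" and f: "locally_bounded f" and S: "bounded S"
  shows "set_integrable lborel S f"
proof -
  obtain B where B: "\<And>x. x \<in> S \<Longrightarrow> \<bar>x\<bar> \<le> B" using S by (auto simp: bounded_iff)
  obtain M where M: "0 \<le> M" "\<And>t. \<bar>t\<bar> \<le> B \<Longrightarrow> \<bar>f t\<bar> \<le> M" using locally_boundedE[OF f] by blast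
  show ?thesis unfolding set_integrable_def
  proof (rule integrableI_bounded_set[where A = "{-B..B}" and B = M])
    show "AE x in lborel. x \<in> {- B..B} \<longrightarrow> norm (indicat_real S x *\<^sub>R f x) \<le> M"
      using M by (intro AE_I2) (auto simp: indicator_def abs_le_iff)
    show "AE x in lborel. x \<notin> {- B..B} \<longrightarrow> indicat_real S x *\<^sub>R f x = 0"
      using B by (intro AE_I2) (force simp: indicator_def)
  qed (auto simp: emeasure_lborel_Icc_eq)
qed

lemma integrable_on_locally_bounded:
  fixes f :: "real \<Rightarrow> real"
  assumes "f \<in> borel_measurable borel" "locally_bounded f"
  shows "f integrable_on {a..b}" "(LINT x:{a..b}|lborel. f x) = integral {a..b} f"
  using set_borel_integral_eq_integral[OF set_integrable_locally_bounded[OF assms(1) _ assms(2), of "{a..b}"]] by auto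

text \<open>Restricted to a bounded interval, the positive and the negative part of \<open>f\<close>
  are densities of two finite measures that agree on all half-lines. The measures coincide, hence so
  do the densities almost everywhere; the intervals with end points \<open>1 / (N + 1)\<close> and
  \<open>N + 1\<close> exhaust the positive axis.\<close>

lemma AE_zero_of_interval_integrals:
  fixes f :: "real \<Rightarrow> real"
  assumes [measurable]: "f \<in> borel_measurable borel" and f: "locally_bounded f"
    and zero: "\<And>x y. 0 < x \<Longrightarrow> x < y \<Longrightarrow> (LINT s:{x<..<y}|lborel. f s) = 0"
  shows "AE s in lborel. 0 < s \<longrightarrow> f s = 0"
proof -
  have N: "AE s in lborel. s \<in> {1 / real (Suc N)<..<real (Suc N)} \<longrightarrow> f s = 0" for N
  proof -
    define S where "S = {1 / real (Suc N)<..<real (Suc N)}"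
    define g where "g s = indicator S s * f s" for s
    have [measurable]: "g \<in> borel_measurable borel" unfolding g_def S_def by measurable
    have int: "integrable lborel (\<lambda>s. indicator T s * g s)" if [measurable]: "T \<in> sets borel" for T
    proof -
      have "set_integrable lborel (T \<inter> S) f"
        by (rule set_integrable_locally_bounded) (auto intro: f bounded_Int simp: S_def)
      then show ?thesis by (simp add: set_integrable_def g_def indicator_inter_arith mult.assoc)
    qed
    have z: "(\<integral>s. indicator {x<..} s * g s \<partial>lborel) = 0" for x
    proof (cases "max x (1 / real (Suc N)) < real (Suc N)")
      case True
      have "(\<integral>s. indicator {x<..} s * g s \<partial>lborel) = (LINT s:{max x (1 / real (Suc N))<..<real (Suc N)}|lborel. f s)"
        unfolding set_lebesgue_integral_def
        by (rule Bochner_Integration.integral_cong) (auto simp: g_def S_def indicator_def)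
      also have "\<dots> = 0" using True by (intro zero) (auto simp: less_max_iff_disj)
      finally show ?thesis .
    next
      case False
      then have "(\<lambda>s. indicator {x<..} s * g s) = (\<lambda>s. 0)"
        by (auto simp: g_def S_def indicator_def)
      then show ?thesis by simp
    qed
    have "density lborel (\<lambda>s. ennreal (max 0 (g s))) = density lborel (\<lambda>s. ennreal (max 0 (- g s)))"
    proof (rule measure_eqI_lessThan)
      fix x
      have e: "emeasure (density lborel (\<lambda>s. ennreal (max 0 (k s)))) {x<..} = ennreal (\<integral>s. indicator {x<..} s * max 0 (k s) \<partial>lborel)"
        and i: "integrable lborel (\<lambda>s. indicator {x<..} s * max 0 (k s))"
        if k: "k = g \<or> k = (\<lambda>s. - g s)" for k
      proof -
        have [measurable]: "k \<in> borel_measurable borel" using k by auto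
        have "integrable lborel (\<lambda>s. indicator {x<..} s * k s)" using k int[of "{x<..}"] by auto
        then have "integrable lborel (\<lambda>s. max 0 (indicator {x<..} s * k s))" by auto
        moreover have "(\<lambda>s. max 0 (indicator {x<..} s * k s)) = (\<lambda>s. indicator {x<..} s * max 0 (k s))"
          by (auto simp: indicator_def)
        ultimately show i: "integrable lborel (\<lambda>s. indicator {x<..} s * max 0 (k s))" by simp
        have "emeasure (density lborel (\<lambda>s. ennreal (max 0 (k s)))) {x<..} = (\<integral>\<^sup>+s. ennreal (max 0 (k s)) * indicator {x<..} s \<partial>lborel)"
          by (subst emeasure_density) auto
        also have "\<dots> = (\<integral>\<^sup>+s. ennreal (indicator {x<..} s * max 0 (k s)) \<partial>lborel)"
          by (rule nn_integral_cong) (auto simp: indicator_def)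
        also have "\<dots> = ennreal (\<integral>s. indicator {x<..} s * max 0 (k s) \<partial>lborel)"
          by (rule nn_integral_eq_integral[OF i]) auto
        finally show "emeasure (density lborel (\<lambda>s. ennreal (max 0 (k s)))) {x<..} = ennreal (\<integral>s. indicator {x<..} s * max 0 (k s) \<partial>lborel)" .
      qed
      show "emeasure (density lborel (\<lambda>s. ennreal (max 0 (g s)))) {x<..} < \<infinity>"
        using e[of g] by simp
      have "(\<integral>s. indicator {x<..} s * max 0 (g s) \<partial>lborel) - (\<integral>s. indicator {x<..} s * max 0 (- g s) \<partial>lborel)
        = (\<integral>s. indicator {x<..} s * max 0 (g s) - indicator {x<..} s * max 0 (- g s) \<partial>lborel)"
        by (rule Bochner_Integration.integral_diff[symmetric]) (use i[of g] i[of "\<lambda>s. - g s"] in auto)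
      also have "\<dots> = (\<integral>s. indicator {x<..} s * g s \<partial>lborel)"
        by (rule Bochner_Integration.integral_cong) (auto simp: indicator_def)
      finally show "emeasure (density lborel (\<lambda>s. ennreal (max 0 (g s)))) {x<..}
        = emeasure (density lborel (\<lambda>s. ennreal (max 0 (- g s)))) {x<..}"
        using z[of x] e[of g] e[of "\<lambda>s. - g s"] by simp
    qed auto
    then have "AE s in lborel. ennreal (max 0 (g s)) = ennreal (max 0 (- g s))"
      by (intro sigma_finite_measure.density_unique[OF sigma_finite_lborel]) auto
    then show ?thesis
    proof eventually_elim
      case (elim s)
      then have "max 0 (g s) = max 0 (- g s)" by (subst (asm) ennreal_inj) auto
      then show ?case by (auto simp: g_def S_def indicator_def max_def split: if_splits)
    qed
  qed
  then have "AE s in lborel. \<forall>N. s \<in> {1 / real (Suc N)<..<real (Suc N)} \<longrightarrow> f s = 0"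
    by (subst AE_all_countable) auto
  then show ?thesis
  proof eventually_elim
    case (elim s)
    show ?case
    proof
      assume s: "0 < s"
      obtain N1 where N1: "1 / s < real N1" using reals_Archimedean2 by blast
      obtain N2 where N2: "s < real N2" using reals_Archimedean2 by blast
      define N where "N = max N1 N2"
      have "1 / s < real (Suc N)" "s < real (Suc N)" using N1 N2 by (auto simp: N_def max_def)
      then have "s \<in> {1 / real (Suc N)<..<real (Suc N)}" using s by (auto simp: field_simps)
      then show "f s = 0" using elim by blast
    qed
  qed
qed

text \<open>As \<open>f\<close> is merely measurable, its primitive cannot be differentiated at
  every point. Fubini on the triangle \<open>0 \<le> x \<le> y \<le> B\<close> replaces the product
  rule, and \<open>G B = 0\<close> removes the boundary term.\<close>

lemma integral_by_parts_measurable: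
  fixes f g G :: "real \<Rightarrow> real"
  assumes [measurable]: "f \<in> borel_measurable borel" and f: "locally_bounded f"
    and G: "\<And>x. x \<in> {0..B} \<Longrightarrow> (G has_real_derivative g x) (at x)" and g: "continuous_on UNIV g"
    and "G B = 0" "0 \<le> B"
  shows "(LINT x:{0..B}|lborel. f x * G x) = - integral {0..B} (\<lambda>y. integral {0..y} f * g y)"
proof -
  have [measurable]: "g \<in> borel_measurable borel" using g by (rule borel_measurable_continuous_onI)
  obtain M where M: "0 \<le> M" "\<And>t. \<bar>t\<bar> \<le> B \<Longrightarrow> \<bar>f t\<bar> \<le> M" using locally_boundedE[OF f] by blast
  obtain N where N: "0 \<le> N" "\<And>t. \<bar>t\<bar> \<le> B \<Longrightarrow> \<bar>g t\<bar> \<le> N" using locally_boundedE[OF locally_bounded_continuous[OF g]] by blast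
  define F where "F x y = (if 0 \<le> x \<and> x \<le> y \<and> y \<le> B then f x * g y else 0)" for x y
  have [measurable]: "(\<lambda>(x, y). F x y) \<in> borel_measurable (lborel \<Otimes>\<^sub>M lborel)"
    unfolding F_def by measurable
  have "integrable (lborel \<Otimes>\<^sub>M lborel) (case_prod F)"
  proof (rule integrableI_bounded_set[where A = "{0..B} \<times> {0..B}" and B = "M * N"])
    have "emeasure (lborel \<Otimes>\<^sub>M lborel) ({0..B} \<times> {0..B}) = emeasure lborel {0..B} * emeasure lborel {0..B}"
      by (rule lborel.emeasure_pair_measure_Times) auto
    then show "emeasure (lborel \<Otimes>\<^sub>M lborel) ({0..B} \<times> {0..B}) < \<infinity>"
      using assms by (simp add: ennreal_mult_less_top)
    show "AE x in lborel \<Otimes>\<^sub>M lborel. x \<in> {0..B} \<times> {0..B} \<longrightarrow> norm (case x of (x, y) \<Rightarrow> F x y) \<le> M * N"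
      using M N by (intro AE_I2) (auto simp: F_def abs_mult intro!: mult_mono)
    show "AE x in lborel \<Otimes>\<^sub>M lborel. x \<notin> {0..B} \<times> {0..B} \<longrightarrow> (case x of (x, y) \<Rightarrow> F x y) = 0"
      by (intro AE_I2) (auto simp: F_def split: if_splits)
  qed auto
  then have fub: "(\<integral>y. (\<integral>x. F x y \<partial>lborel) \<partial>lborel) = (\<integral>x. (\<integral>y. F x y \<partial>lborel) \<partial>lborel)"
    by (rule lborel_pair.Fubini_integral)
  have in1: "(\<integral>x. F x y \<partial>lborel) = indicator {0..B} y * (integral {0..y} f * g y)" for y
  proof (cases "y \<in> {0..B}")
    case True
    have "(\<integral>x. F x y \<partial>lborel) = (LINT x:{0..y}|lborel. f x) * g y"
      unfolding set_lebesgue_integral_def integral_mult_left_zero[symmetric]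
      by (rule Bochner_Integration.integral_cong) (use True in \<open>auto simp: F_def indicator_def\<close>)
    then show ?thesis using True f by (simp add: integrable_on_locally_bounded)
  next
    case False
    then have "F x y = 0" for x by (auto simp: F_def)
    then show ?thesis using False by simp
  qed
  have in2: "(\<integral>y. F x y \<partial>lborel) = - (indicator {0..B} x * (f x * G x))" for x
  proof (cases "x \<in> {0..B}")
    case True
    have "(\<integral>y. F x y \<partial>lborel) = f x * (LINT y:{x..B}|lborel. g y)"
      unfolding set_lebesgue_integral_def integral_mult_right_zero[symmetric]
      by (rule Bochner_Integration.integral_cong) (use True in \<open>auto simp: F_def indicator_def\<close>)
    also have "(LINT y:{x..B}|lborel. g y) = integral {x..B} g"
      using g by (intro integrable_on_locally_bounded locally_bounded_continuous) auto
    also have "(g has_integral G B - G x) {x..B}"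
      using True G by (intro fundamental_theorem_of_calculus)
        (auto simp: has_real_derivative_iff_has_vector_derivative[symmetric] intro!: DERIV_subset[OF G])
    then have "integral {x..B} g = - G x" using assms by (simp add: integral_unique)
    finally show ?thesis using True by simp
  next
    case False
    then have "F x y = 0" for y by (auto simp: F_def)
    then show ?thesis using False by simp
  qed
  have "(LINT x:{0..B}|lborel. f x * G x) = - (\<integral>x. (\<integral>y. F x y \<partial>lborel) \<partial>lborel)"
    unfolding in2 set_lebesgue_integral_def by simp
  also have "\<dots> = - (LINT y:{0..B}|lborel. integral {0..y} f * g y)"
    unfolding fub[symmetric] in1 set_lebesgue_integral_def by simp
  also have "(LINT y:{0..B}|lborel. integral {0..y} f * g y) = integral {0..B} (\<lambda>y. integral {0..y} f * g y)"
  proof (rule set_borel_integral_eq_integral(2))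
    show "set_integrable lborel {0..B} (\<lambda>y. integral {0..y} f * g y)"
      using f g by (intro borel_integrable_atLeastAtMost' continuous_intros indefinite_integral_continuous_1
          integrable_on_locally_bounded(1)) (auto intro: continuous_on_subset)
  qed
  finally show ?thesis .
qed

subsection \<open>Radial distributional solutions\<close>

lemma antiderivative_exists:
  fixes f :: "real \<Rightarrow> real"
  assumes "continuous_on UNIV f"
  obtains F where "\<And>x. (F has_real_derivative f x) (at x)" "F c = 0"
proof -
  obtain F where F: "\<And>x. (F has_vector_derivative f x) (at x)"
    using einterval_antiderivative[of "-\<infinity>" "\<infinity>" f] assms by (auto simp: continuous_on_eq_continuous_at)
  show ?thesis
    by (rule that[of "\<lambda>x. F x - F c"])
      (use F in \<open>auto intro!: derivative_eq_intros simp: has_real_derivative_iff_has_vector_derivative\<close>)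
qed

text \<open>Working with \<open>x \<bullet> x\<close> in place of the norm keeps the composition
  smooth at the origin.\<close>

lemma laplacian_radial:
  fixes g :: "real \<Rightarrow> real" and x :: "'a::euclidean_space"
  assumes g: "\<And>t. (g has_real_derivative g' t) (at t)" and g': "\<And>t. (g' has_real_derivative g'' t) (at t)"
  shows "laplacian (\<lambda>x. g (x \<bullet> x)) x = 2 * real DIM('a) * g' (x \<bullet> x) + 4 * (x \<bullet> x) * g'' (x \<bullet> x)"
proof -
  have inner: "((\<lambda>x. x \<bullet> x) has_derivative (\<lambda>h. 2 * (y \<bullet> h))) (at y)" for y :: 'a
    by (auto intro!: derivative_eq_intros simp: inner_commute)
  have comp: "((\<lambda>x. k (x \<bullet> x)) has_derivative (\<lambda>h. k' (y \<bullet> y) * (2 * (y \<bullet> h)))) (at y)"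
    if "\<And>t. (k has_real_derivative k' t) (at t)" for k k' and y :: 'a
    using has_derivative_compose[OF inner that[unfolded has_field_derivative_def]] .
  have p1: "partial_derivative b (\<lambda>x. g (x \<bullet> x)) = (\<lambda>y::'a. g' (y \<bullet> y) * (2 * (y \<bullet> b)))" for b
    using partial_derivative_eq[OF comp[OF g]] by auto
  have p2: "partial_derivative b (\<lambda>y::'a. g' (y \<bullet> y) * (2 * (y \<bullet> b))) x
      = 2 * g' (x \<bullet> x) + 4 * g'' (x \<bullet> x) * ((x \<bullet> b) * (x \<bullet> b))" if "b \<in> Basis" for b
  proof -
    have "((\<lambda>y::'a. g' (y \<bullet> y) * (2 * (y \<bullet> b))) has_derivative
      (\<lambda>h. g' (x \<bullet> x) * (2 * (h \<bullet> b)) + g'' (x \<bullet> x) * (2 * (x \<bullet> h)) * (2 * (x \<bullet> b)))) (at x)"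
      by (rule has_derivative_mult[OF comp[OF g']]) (auto intro!: derivative_eq_intros)
    from partial_derivative_eq[OF this, of b] show ?thesis using that by simp
  qed
  have "laplacian (\<lambda>x. g (x \<bullet> x)) x = (\<Sum>b\<in>Basis. 2 * g' (x \<bullet> x) + 4 * g'' (x \<bullet> x) * ((x \<bullet> b) * (x \<bullet> b)))"
    unfolding laplacian_def p1 by (rule sum.cong) (auto simp: p2)
  also have "\<dots> = 2 * real DIM('a) * g' (x \<bullet> x) + 4 * g'' (x \<bullet> x) * (\<Sum>b\<in>Basis. (x \<bullet> b) * (x \<bullet> b))"
    by (simp add: sum.distrib sum_distrib_left)
  also have "(\<Sum>b\<in>Basis. (x \<bullet> b) * (x \<bullet> b)) = x \<bullet> x" by (rule euclidean_inner[symmetric])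
  finally show ?thesis by (simp add: mult_ac)
qed

text \<open>The choice \<open>g' t = X t t powr (- n / 2)\<close> with \<open>X' = \<xi>\<close> turns the Laplacian of \<open>g |x|\<^sup>2\<close> into
  \<open>4 |x| powr (2 - n) \<xi> |x|\<^sup>2\<close>, which is a prescribed weight in polar coordinates.\<close>

lemma radial_test_function:
  fixes \<xi> :: "real \<Rightarrow> real"
  assumes smooth: "\<And>j. continuously_differentiable j \<xi>" and ab: "0 < a" "a < b"
    and supp: "\<And>t. t \<notin> {a<..<b} \<Longrightarrow> \<xi> t = 0" and zero: "(\<integral>t. \<xi> t \<partial>lborel) = 0"
  obtains X g where
    "test_function (\<lambda>x::'a::euclidean_space. g (x \<bullet> x))"
    "\<And>x::'a. laplacian (\<lambda>x::'a. g (x \<bullet> x)) x = 4 * (x \<bullet> x) powr (1 - real DIM('a) / 2) * \<xi> (x \<bullet> x)"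
    "\<And>t. (X has_real_derivative \<xi> t) (at t)"
    "\<And>t. (g has_real_derivative X t * t powr (- real DIM('a) / 2)) (at t)"
    "continuous_on UNIV (\<lambda>t. X t * t powr (- real DIM('a) / 2))"
    "\<And>t. b \<le> t \<Longrightarrow> g t = 0" "\<And>t. t \<notin> {a<..<b} \<Longrightarrow> X t = 0"
proof -
  define c where "c = - real DIM('a) / 2"
  have contchi: "continuous_on UNIV \<xi>" using smooth[of 0] by simp
  obtain X where X: "\<And>t. (X has_real_derivative \<xi> t) (at t)" "X a = 0"
    using antiderivative_exists[OF contchi, of a] by blast
  have const: "F t = F s" if "s \<le> t" "\<And>y. y \<in> {s..t} \<Longrightarrow> (F has_real_derivative 0) (at y)" for F s t
    using DERIV_isconst_end[of s t F] that by (cases "s = t") (force intro: DERIV_continuous_on DERIV_subset)+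
  \<comment> \<open>Here the mean-zero condition is spent: \<open>X\<close> returns to 0 at
    \<open>b\<close>, so \<open>g\<close> is constant beyond \<open>b\<close> and the normalisation
    \<open>g b = 0\<close> gives compact support.\<close>
  have "X b = 0"
  proof -
    have "(\<integral>t. \<xi> t * indicator {a..b} t \<partial>lborel) = X b - X a"
      by (rule integral_FTC_Icc_real) (use ab X(1) contchi in \<open>auto simp: continuous_on_eq_continuous_at\<close>)
    moreover have "(\<lambda>t. \<xi> t * indicator {a..b} t) = \<xi>"
    proof
      fix t
      show "\<xi> t * indicator {a..b} t = \<xi> t" using supp[of t] by (cases "t \<in> {a..b}") auto
    qed
    ultimately show ?thesis using zero X(2) by simp
  qed
  have X0: "X t = 0" if t: "t \<notin> {a<..<b}" for t
  proof (cases "t \<le> a")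
    case True
    have "X a = X t"
    proof (rule const[OF True])
      fix y assume "y \<in> {t..a}"
      then show "(X has_real_derivative 0) (at y)" using X(1)[of y] supp[of y] by auto
    qed
    then show ?thesis using X(2) by simp
  next
    case False
    then have "b \<le> t" using t by auto
    have "X t = X b"
    proof (rule const[OF \<open>b \<le> t\<close>])
      fix y assume "y \<in> {b..t}"
      then show "(X has_real_derivative 0) (at y)" using X(1)[of y] supp[of y] by auto
    qed
    then show ?thesis using \<open>X b = 0\<close> by simp
  qed
  have smX: "continuously_differentiable j X" for j
    using continuously_differentiable_realI[OF X(1) smooth] continuously_differentiable_lower by blast
  define \<theta> where "\<theta> t = X t * t powr c" for t
  have smth: "continuously_differentiable j \<theta>" for j
    unfolding \<theta>_def[abs_def] by (rule continuously_differentiable_cutoff_powr[OF ab(1)]) (use smX X0 in auto)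
  have contth: "continuous_on UNIV \<theta>" using smth[of 0] by simp
  obtain g where g: "\<And>t. (g has_real_derivative \<theta> t) (at t)" "g b = 0"
    using antiderivative_exists[OF contth, of b] by blast
  have g0: "g t = 0" if "b \<le> t" for t
  proof -
    have "g t = g b"
    proof (rule const[OF that])
      fix y assume "y \<in> {b..t}"
      then show "(g has_real_derivative 0) (at y)" using g(1)[of y] X0[of y] by (auto simp: \<theta>_def)
    qed
    then show ?thesis using g(2) by simp
  qed
  have smg: "continuously_differentiable j g" for j
    using continuously_differentiable_realI[OF g(1) smth] continuously_differentiable_lower by blast
  define \<theta>' where "\<theta>' t = \<xi> t * t powr c + X t * (c * t powr (c - 1))" for t
  have Dth: "(\<theta> has_real_derivative \<theta>' t) (at t)" for t
  proof (cases "t < a")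
    case True
    have "(\<theta> has_real_derivative 0) (at t)"
      by (rule DERIV_zero_of_vanishing[OF _ True]) (simp add: \<theta>_def X0)
    then show ?thesis using True by (simp add: \<theta>'_def X0 supp)
  next
    case False
    then have "0 < t" using ab by simp
    show ?thesis unfolding \<theta>_def \<theta>'_def
      by (rule DERIV_cong[OF DERIV_mult[OF X(1) has_real_derivative_powr[OF \<open>0 < t\<close>]]]) (simp add: mult_ac)
  qed
  show ?thesis
  proof (rule that[of g X])
    show "test_function (\<lambda>x::'a. g (x \<bullet> x))"
      unfolding test_function_def
    proof
      show "\<forall>k. continuously_differentiable k (\<lambda>x::'a. g (x \<bullet> x))"
        by (rule allI, rule continuously_differentiable_compose[OF smg continuously_differentiable_inner_self])
      have "{x::'a. g (x \<bullet> x) \<noteq> 0} \<subseteq> cball 0 (sqrt b)"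
      proof
        fix x :: 'a assume "x \<in> {x. g (x \<bullet> x) \<noteq> 0}"
        then have "x \<bullet> x < b" using g0[of "x \<bullet> x"] by force
        then show "x \<in> cball 0 (sqrt b)" by (simp add: norm_eq_sqrt_inner)
      qed
      then show "compact (closure {x::'a. g (x \<bullet> x) \<noteq> 0})"
        using bounded_subset bounded_cball by (auto simp: compact_closure)
    qed
    show "laplacian (\<lambda>x::'a. g (x \<bullet> x)) x = 4 * (x \<bullet> x) powr (1 - real DIM('a) / 2) * \<xi> (x \<bullet> x)" for x :: 'a
    proof (cases "x \<bullet> x < a")
      case True
      then show ?thesis unfolding laplacian_radial[OF g(1) Dth] by (simp add: \<theta>_def \<theta>'_def X0 supp)
    next
      case False
      then have t: "0 < x \<bullet> x" using ab by linarith
      \<comment> \<open>With \<open>t = x \<bullet> x\<close> and \<open>n\<close> the dimension,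
        the terms of \<open>2 n \<theta> + 4 t \<theta>'\<close> containing \<open>X\<close> have
        total coefficient \<open>2 n + 4 c\<close>, which the exponent \<open>c = - n / 2\<close>
        makes zero.\<close>
      have "(x \<bullet> x) powr (c - 1) = (x \<bullet> x) powr c / (x \<bullet> x)" "(x \<bullet> x) powr (1 + c) = (x \<bullet> x) * (x \<bullet> x) powr c"
        using t by (simp_all add: powr_diff powr_add del: inner_gt_zero_iff)
      moreover have "1 - real DIM('a) / 2 = 1 + c" "2 * real DIM('a) = - 4 * c" by (simp_all add: c_def)
      ultimately show ?thesis unfolding laplacian_radial[OF g(1) Dth] \<theta>_def \<theta>'_def
        using t by (simp add: field_simps)
    qed
    show "(g has_real_derivative X t * t powr (- real DIM('a) / 2)) (at t)" for t
      using g(1) by (simp add: \<theta>_def c_def)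
    show "continuous_on UNIV (\<lambda>t. X t * t powr (- real DIM('a) / 2))"
      using contth by (simp add: \<theta>_def[abs_def] c_def)
  qed (use X g0 X0 in auto)
qed

section \<open>The integrated radial equation\<close>

definition flux :: "nat \<Rightarrow> (real \<Rightarrow> real) \<Rightarrow> real \<Rightarrow> real" where
  "flux n F r = integral {0..r} (\<lambda>t. F t * t ^ (n - 1))"

text \<open>If \<open>- (r ^ (n - 1) w')' = r ^ (n - 1) F\<close> with \<open>w\<close> regular at
  0, then \<open>slope\<close> is \<open>- w'\<close> and \<open>decrement\<close> is
  \<open>w 0 - w r\<close>. Both vanish for \<open>r \<le> 0\<close>, since integrals over empty
  intervals and the quotient at 0 evaluate to 0; this makes them well behaved on the whole
  line.\<close>

definition slope :: "nat \<Rightarrow> (real \<Rightarrow> real) \<Rightarrow> real \<Rightarrow> real" where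
  "slope n F r = flux n F r / r ^ (n - 1)"

definition decrement :: "nat \<Rightarrow> (real \<Rightarrow> real) \<Rightarrow> real \<Rightarrow> real" where
  "decrement n F r = integral {0..r} (slope n F)"

lemma flux_nonpos_arg: "r \<le> 0 \<Longrightarrow> flux n F r = 0"
  by (cases "r = 0") (auto simp: flux_def)

context
  fixes n :: nat and F :: "real \<Rightarrow> real"
  assumes F_meas [measurable]: "F \<in> borel_measurable borel" and F_bdd: "locally_bounded F"
begin

lemma F_weighted: "(\<lambda>t. F t * t ^ (n - 1)) \<in> borel_measurable borel" "locally_bounded (\<lambda>t. F t * t ^ (n - 1))"
  by (simp, intro locally_bounded_mult[OF F_bdd] locally_bounded_continuous continuous_intros)

text \<open>A bound \<open>M\<close> on \<open>F\<close> bounds the flux by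
  \<open>M * r * r ^ (n - 1)\<close>. The linear rate settles continuity at 0, where the defining
  quotient degenerates.\<close>

lemma slope_bound: "\<exists>M. \<forall>r. \<bar>r\<bar> \<le> B \<longrightarrow> \<bar>slope n F r\<bar> \<le> M * \<bar>r\<bar>"
proof -
  obtain M where M: "0 \<le> M" "\<And>t. \<bar>t\<bar> \<le> B \<Longrightarrow> \<bar>F t\<bar> \<le> M" using locally_boundedE[OF F_bdd] by blast
  have "\<bar>slope n F r\<bar> \<le> M * \<bar>r\<bar>" if r: "\<bar>r\<bar> \<le> B" for r
  proof (cases "0 < r")
    case True
    have "norm (flux n F r) \<le> integral {0..r} (\<lambda>t. M * r ^ (n - 1))"
      unfolding flux_def
    proof (rule integral_norm_bound_integral)
      fix t assume t: "t \<in> {0..r}"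
      then have "\<bar>F t\<bar> \<le> M" "t ^ (n - 1) \<le> r ^ (n - 1)" using M r by (auto intro: power_mono)
      then show "norm (F t * t ^ (n - 1)) \<le> M * r ^ (n - 1)" using t M by (auto simp: abs_mult intro!: mult_mono)
    qed (rule integrable_on_locally_bounded[OF F_weighted], rule integrable_const_ivl)
    then have "\<bar>flux n F r\<bar> \<le> M * r * r ^ (n - 1)" using True by (simp add: mult_ac)
    then show ?thesis using True by (simp add: slope_def abs_divide divide_le_eq)
  next
    case False
    then show ?thesis using M by (simp add: slope_def flux_nonpos_arg mult_nonneg_nonpos)
  qed
  then show ?thesis by blast
qed

lemma continuous_slope: "continuous_on UNIV (slope n F)"
proof -
  have "isCont (slope n F) r" for r
  proof -
    consider "r < 0" | "r = 0" | "0 < r" by linarith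
    then show ?thesis
    proof cases
      case 1
      show ?thesis
        by (rule DERIV_isCont[OF DERIV_zero_of_vanishing[OF _ 1]]) (simp add: slope_def flux_nonpos_arg)
    next
      case 2
      obtain M where M: "\<And>r. \<bar>r\<bar> \<le> 1 \<Longrightarrow> \<bar>slope n F r\<bar> \<le> M * \<bar>r\<bar>" using slope_bound by blast
      have "((\<lambda>r. M * \<bar>r\<bar>) \<longlongrightarrow> M * \<bar>0\<bar>) (at 0)" by (intro tendsto_intros)
      then have "((\<lambda>r. M * \<bar>r\<bar>) \<longlongrightarrow> 0) (at 0)" by simp
      moreover have "eventually (\<lambda>r. norm (slope n F r) \<le> M * \<bar>r\<bar>) (at 0)"
        unfolding eventually_at by (intro exI[of _ 1]) (auto intro: M simp: dist_real_def)
      ultimately have "(slope n F \<longlongrightarrow> 0) (at 0)" by (rule Lim_null_comparison[rotated])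
      then show ?thesis unfolding 2 isCont_def by (simp add: slope_def flux_nonpos_arg)
    next
      case 3
      have "continuous_on {0..r + 1} (flux n F)" unfolding flux_def
        by (intro indefinite_integral_continuous_1 integrable_on_locally_bounded F_weighted)
      then have "isCont (flux n F) r" using 3 by (intro continuous_on_interior) auto
      then show ?thesis unfolding slope_def[abs_def] using 3 by (intro continuous_intros) auto
    qed
  qed
  then show ?thesis by (simp add: continuous_on_eq_continuous_at)
qed

lemma DERIV_decrement: "(decrement n F has_real_derivative slope n F r) (at r)"
proof -
  \<comment> \<open>Starting the integral at \<open>- c\<close> changes nothing, because the slope
    vanishes on the negative axis, but makes \<open>r\<close> an interior point and yields a
    two-sided derivative also at 0.\<close>
  define c where "c = \<bar>r\<bar> + 1"
  have int: "slope n F integrable_on {x..y}" for x y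
    by (intro integrable_continuous_interval continuous_on_subset[OF continuous_slope]) auto
  have z: "integral {- c..s} (slope n F) = 0" if "s \<le> 0" for s
    by (rule integral_unique[OF has_integral_is_0]) (use that in \<open>auto simp: slope_def flux_nonpos_arg\<close>)
  have eq: "integral {- c..s} (slope n F) = decrement n F s" for s
  proof (cases "0 \<le> s")
    case True
    then show ?thesis
      using Henstock_Kurzweil_Integration.integral_combine[OF _ True int, of "- c"] z[of 0]
      by (simp add: c_def decrement_def)
  next
    case False
    then show ?thesis using z[of s] by (simp add: decrement_def)
  qed
  have "((\<lambda>s. integral {- c..s} (slope n F)) has_real_derivative slope n F r) (at r within {- c..c})"
    by (rule integral_has_real_derivative) (auto intro: continuous_on_subset[OF continuous_slope] simp: c_def)
  then show ?thesis unfolding eq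
    by (subst (asm) at_within_interior) (auto simp: c_def)
qed

lemma continuous_decrement: "continuous_on UNIV (decrement n F)"
  using DERIV_isCont[OF DERIV_decrement] by (simp add: continuous_on_eq_continuous_at)

end

text \<open>In polar coordinates the Laplacian side becomes a multiple of the integral of
  \<open>W r * r * \<xi> (r\<^sup>2)\<close>. Two integrations by parts bring the source side to the
  same weight: the first trades \<open>F\<close> for its flux, the second trades the slope for
  \<open>decrement\<close>.\<close>

lemma weak_radial_equation:
  fixes w f :: "'a::euclidean_space \<Rightarrow> real" and W F \<xi> :: "real \<Rightarrow> real"
  defines "n \<equiv> DIM('a)"
  assumes weak: "neg_laplacian_eq w f"
    and w: "\<And>x. w x = W (norm x)" and f: "\<And>x. f x = F (norm x)"
    and [measurable]: "W \<in> borel_measurable borel" "F \<in> borel_measurable borel"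
    and bdd: "locally_bounded W" "locally_bounded F"
    and smooth: "\<And>j. continuously_differentiable j \<xi>" and ab: "0 < a" "a < b"
    and supp: "\<And>t. t \<notin> {a<..<b} \<Longrightarrow> \<xi> t = 0" and zero: "(\<integral>t. \<xi> t \<partial>lborel) = 0"
    and B: "0 \<le> B" "b \<le> B\<^sup>2"
  shows "(LINT r:{0..B}|lborel. (W r + decrement n F r) * (r * \<xi> (r\<^sup>2))) = 0"
proof (rule radial_test_function[where 'a = 'a, OF smooth ab supp zero])
  fix X g
  assume tf: "test_function (\<lambda>x::'a. g (x \<bullet> x))"
    and lap: "\<And>x::'a. laplacian (\<lambda>x::'a. g (x \<bullet> x)) x = 4 * (x \<bullet> x) powr (1 - real DIM('a) / 2) * \<xi> (x \<bullet> x)"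
    and X: "\<And>t. (X has_real_derivative \<xi> t) (at t)"
    and g: "\<And>t. (g has_real_derivative X t * t powr (- real DIM('a) / 2)) (at t)"
    and g': "continuous_on UNIV (\<lambda>t. X t * t powr (- real DIM('a) / 2))"
    and g0: "\<And>t. b \<le> t \<Longrightarrow> g t = 0" and X0: "\<And>t. t \<notin> {a<..<b} \<Longrightarrow> X t = 0"
  have n: "1 \<le> n" by (simp add: n_def Suc_leI)
  define K where "K = real n * unit_ball_vol n"
  have K: "K \<noteq> 0" using n less_imp_neq[OF unit_ball_vol_pos[of "real n"]] by (simp add: K_def)
  have contxi: "continuous_on UNIV \<xi>" using smooth[of 0] by simp
  have [measurable]: "\<xi> \<in> borel_measurable borel" using contxi by (rule borel_measurable_continuous_onI)
  have contg: "continuous_on UNIV g" using DERIV_isCont[OF g] by (simp add: continuous_on_eq_continuous_at)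
  then have [measurable]: "g \<in> borel_measurable borel" by (rule borel_measurable_continuous_onI)
  have contX: "continuous_on UNIV X" using DERIV_isCont[OF X] by (simp add: continuous_on_eq_continuous_at)
  have big: "b \<le> r\<^sup>2" if "B \<le> r" for r
    using B that power_mono[of B r 2] by linarith
  \<comment> \<open>The first identity cancels the Jacobian against the power in the Laplacian; the
    second turns the flux into the slope.\<close>
  have wt: "r ^ (n - 1) * (r\<^sup>2) powr (1 - real n / 2) = r" "(r\<^sup>2) powr (- real n / 2) * r = 1 / r ^ (n - 1)"
    if r: "0 < r" for r :: real
  proof -
    have sq: "r\<^sup>2 = r powr 2" using r by simp
    have "r ^ (n - 1) = r powr (real n - 1)"
      using powr_realpow[OF r, of "n - 1"] n by (simp add: of_nat_diff)
    moreover have "(r\<^sup>2) powr (1 - real n / 2) = r powr (2 - real n)" "(r\<^sup>2) powr (- real n / 2) = r powr (- real n)"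
      unfolding sq powr_powr by (simp_all add: algebra_simps)
    moreover have "r powr (real n - 1) * r powr (2 - real n) = r powr 1" by (simp add: powr_add[symmetric])
    moreover have "r powr (- real n) * r powr 1 = r powr (- (real n - 1))" by (subst powr_add[symmetric]) simp
    moreover have "r powr (- (real n - 1)) = 1 / r powr (real n - 1)" by (rule powr_minus_divide)
    moreover have "r powr 1 = r" using r by simp
    ultimately show "r ^ (n - 1) * (r\<^sup>2) powr (1 - real n / 2) = r" "(r\<^sup>2) powr (- real n / 2) * r = 1 / r ^ (n - 1)"
      by metis+
  qed
  have "(\<integral>x. w x * laplacian (\<lambda>x::'a. g (x \<bullet> x)) x \<partial>lborel)
    = (\<integral>x. W (norm (x::'a)) * (4 * ((norm x)\<^sup>2) powr (1 - real n / 2) * \<xi> ((norm x)\<^sup>2)) \<partial>lborel)"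
    by (simp add: w lap n_def power2_norm_eq_inner)
  also have "\<dots> = (\<integral>r. radial_density n r * (W r * (4 * (r\<^sup>2) powr (1 - real n / 2) * \<xi> (r\<^sup>2))) \<partial>lborel)"
    unfolding n_def by (rule integral_radial) measurable
  also have "\<dots> = (\<integral>r. (4 * K) * (indicator {0..B} r *\<^sub>R (W r * (r * \<xi> (r\<^sup>2)))) \<partial>lborel)"
  proof (rule Bochner_Integration.integral_cong)
    fix r :: real
    show "radial_density n r * (W r * (4 * (r\<^sup>2) powr (1 - real n / 2) * \<xi> (r\<^sup>2)))
      = (4 * K) * (indicator {0..B} r *\<^sub>R (W r * (r * \<xi> (r\<^sup>2))))"
    proof (cases "0 < r \<and> r \<le> B")
      case True
      have "radial_density n r * (W r * (4 * (r\<^sup>2) powr (1 - real n / 2) * \<xi> (r\<^sup>2)))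
        = 4 * K * W r * \<xi> (r\<^sup>2) * (r ^ (n - 1) * (r\<^sup>2) powr (1 - real n / 2))"
        using True by (simp add: radial_density_def K_def)
      also have "\<dots> = 4 * K * W r * \<xi> (r\<^sup>2) * r"
        using True by (subst wt(1)) auto
      finally show ?thesis using True by simp
    next
      case False
      then consider "r < 0" | "r = 0" | "0 < r" "B < r" by linarith
      then show ?thesis
      proof cases
        case 1
        then show ?thesis by (simp add: radial_density_def)
      next
        case 2
        then show ?thesis using supp[of 0] ab by simp
      next
        case 3
        then have "\<xi> (r\<^sup>2) = 0" using big[of r] supp[of "r\<^sup>2"] by auto
        then show ?thesis by simp
      qed
    qed
  qed simp
  finally have lhs: "(\<integral>x. w x * laplacian (\<lambda>x::'a. g (x \<bullet> x)) x \<partial>lborel) = 4 * K * (LINT r:{0..B}|lborel. W r * (r * \<xi> (r\<^sup>2)))"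
    unfolding set_lebesgue_integral_def by (simp only: integral_mult_right_zero)
  have "(\<integral>x. f x * g (x \<bullet> x) \<partial>lborel) = (\<integral>x. F (norm (x::'a)) * g ((norm x)\<^sup>2) \<partial>lborel)"
    by (simp add: f power2_norm_eq_inner)
  also have "\<dots> = (\<integral>r. radial_density n r * (F r * g (r\<^sup>2)) \<partial>lborel)"
    unfolding n_def by (rule integral_radial) measurable
  also have "\<dots> = (\<integral>r. K * (indicator {0..B} r *\<^sub>R ((F r * r ^ (n - 1)) * g (r\<^sup>2))) \<partial>lborel)"
  proof (rule Bochner_Integration.integral_cong)
    fix r :: real
    have "g (r\<^sup>2) = 0" if "B < r" using g0 big[of r] that by simp
    then show "radial_density n r * (F r * g (r\<^sup>2)) = K * (indicator {0..B} r *\<^sub>R ((F r * r ^ (n - 1)) * g (r\<^sup>2)))"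
      by (cases "B < r") (auto simp: radial_density_def K_def indicator_def)
  qed simp
  also have "\<dots> = K * (LINT r:{0..B}|lborel. (F r * r ^ (n - 1)) * g (r\<^sup>2))"
    unfolding set_lebesgue_integral_def by (simp only: integral_mult_right_zero)
  also have "(LINT r:{0..B}|lborel. (F r * r ^ (n - 1)) * g (r\<^sup>2))
    = - integral {0..B} (\<lambda>y. integral {0..y} (\<lambda>t. F t * t ^ (n - 1)) * (X (y\<^sup>2) * (y\<^sup>2) powr (- real n / 2) * (2 * y)))"
  proof (rule integral_by_parts_measurable)
    show "((\<lambda>r. g (r\<^sup>2)) has_real_derivative X (x\<^sup>2) * (x\<^sup>2) powr (- real n / 2) * (2 * x)) (at x)" for x
      unfolding n_def by (rule DERIV_cong[OF DERIV_chain'[OF _ g]]) (auto intro!: derivative_eq_intros)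
    show "continuous_on UNIV (\<lambda>x. X (x\<^sup>2) * (x\<^sup>2) powr (- real n / 2) * (2 * x))"
      unfolding n_def by (intro continuous_intros continuous_on_compose2[OF g']) auto
    show "g (B\<^sup>2) = 0" using g0 B by simp
  qed (use F_weighted[of F] bdd B in auto)
  also have "integral {0..B} (\<lambda>y. integral {0..y} (\<lambda>t. F t * t ^ (n - 1)) * (X (y\<^sup>2) * (y\<^sup>2) powr (- real n / 2) * (2 * y)))
    = integral {0..B} (\<lambda>y. 2 * (slope n F y * X (y\<^sup>2)))"
  proof (rule Henstock_Kurzweil_Integration.integral_cong)
    fix y assume y: "y \<in> {0..B}"
    show "integral {0..y} (\<lambda>t. F t * t ^ (n - 1)) * (X (y\<^sup>2) * (y\<^sup>2) powr (- real n / 2) * (2 * y)) = 2 * (slope n F y * X (y\<^sup>2))"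
    proof (cases "y = 0")
      case True
      then show ?thesis using X0[of 0] ab by simp
    next
      case False
      have "flux n F y * (X (y\<^sup>2) * (y\<^sup>2) powr (- real n / 2) * (2 * y))
        = flux n F y * X (y\<^sup>2) * 2 * ((y\<^sup>2) powr (- real n / 2) * y)" by simp
      also have "\<dots> = 2 * (slope n F y * X (y\<^sup>2))" using wt(2)[of y] False y by (simp add: slope_def)
      finally show ?thesis by (simp add: flux_def)
    qed
  qed
  also have "integral {0..B} (\<lambda>y. 2 * (slope n F y * X (y\<^sup>2))) = 2 * integral {0..B} (\<lambda>y. slope n F y * X (y\<^sup>2))"
    by simp
  \<comment> \<open>Now the primitive is differentiable, so the ordinary product rule suffices. The
    boundary terms vanish because \<open>X\<close> is 0 at 0 and from \<open>b\<close> on, and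
    \<open>b \<le> B\<^sup>2\<close>.\<close>
  also have "integral {0..B} (\<lambda>y. slope n F y * X (y\<^sup>2)) = - integral {0..B} (\<lambda>y. 2 * (decrement n F y * (y * \<xi> (y\<^sup>2))))"
  proof -
    have c: "continuous_on {0..B} (\<lambda>y. slope n F y * X (y\<^sup>2))" "continuous_on {0..B} (\<lambda>y. 2 * (decrement n F y * (y * \<xi> (y\<^sup>2))))"
      using bdd by (auto intro!: continuous_intros continuous_on_compose2[OF contX] continuous_on_compose2[OF contxi]
        continuous_on_subset[OF continuous_slope] continuous_on_subset[OF continuous_decrement])
    have "((\<lambda>y. slope n F y * X (y\<^sup>2) + 2 * (decrement n F y * (y * \<xi> (y\<^sup>2)))) has_integral
        decrement n F B * X (B\<^sup>2) - decrement n F 0 * X (0\<^sup>2)) {0..B}"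
    proof (rule fundamental_theorem_of_calculus[OF B(1)])
      fix y
      have "((\<lambda>y. X (y\<^sup>2)) has_real_derivative \<xi> (y\<^sup>2) * (2 * y)) (at y)"
        by (rule DERIV_cong[OF DERIV_chain'[OF _ X]]) (auto intro!: derivative_eq_intros)
      from DERIV_mult[OF DERIV_decrement[of F n y] this]
      have "((\<lambda>y. decrement n F y * X (y\<^sup>2)) has_real_derivative slope n F y * X (y\<^sup>2) + 2 * (decrement n F y * (y * \<xi> (y\<^sup>2)))) (at y)"
        using bdd by (simp add: mult_ac)
      then show "((\<lambda>y. decrement n F y * X (y\<^sup>2)) has_vector_derivative slope n F y * X (y\<^sup>2) + 2 * (decrement n F y * (y * \<xi> (y\<^sup>2)))) (at y within {0..B})"
        by (auto simp: has_real_derivative_iff_has_vector_derivative intro: has_vector_derivative_at_within)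
    qed
    moreover have "X (B\<^sup>2) = 0" "X (0\<^sup>2) = 0" using B ab by (auto intro!: X0)
    ultimately have "integral {0..B} (\<lambda>y. slope n F y * X (y\<^sup>2) + 2 * (decrement n F y * (y * \<xi> (y\<^sup>2)))) = 0"
      by (simp add: integral_unique)
    then show ?thesis
      using Henstock_Kurzweil_Integration.integral_add[OF integrable_continuous_interval[OF c(1)] integrable_continuous_interval[OF c(2)]]
      by linarith
  qed
  also have "integral {0..B} (\<lambda>y. 2 * (decrement n F y * (y * \<xi> (y\<^sup>2)))) = 2 * integral {0..B} (\<lambda>y. decrement n F y * (y * \<xi> (y\<^sup>2)))"
    by simp
  finally have rhs: "(\<integral>x. f x * g (x \<bullet> x) \<partial>lborel) = 4 * K * integral {0..B} (\<lambda>y. decrement n F y * (y * \<xi> (y\<^sup>2)))"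
    by simp
  have contm: "continuous_on UNIV (\<lambda>y. y * \<xi> (y\<^sup>2))"
    by (intro continuous_intros continuous_on_compose2[OF contxi]) auto
  have contd: "continuous_on UNIV (decrement n F)" using bdd by (intro continuous_decrement) auto
  have sd: "(LINT r:{0..B}|lborel. decrement n F r * (r * \<xi> (r\<^sup>2))) = integral {0..B} (\<lambda>y. decrement n F y * (y * \<xi> (y\<^sup>2)))"
    by (intro set_borel_integral_eq_integral(2) borel_integrable_atLeastAtMost' continuous_on_subset[OF continuous_on_mult[OF contd contm]]) auto
  have "- (\<integral>x. w x * laplacian (\<lambda>x::'a. g (x \<bullet> x)) x \<partial>lborel) = (\<integral>x. f x * g (x \<bullet> x) \<partial>lborel)"
    using weak tf unfolding neg_laplacian_eq_def by blast
  then have "(4 * K) * ((LINT r:{0..B}|lborel. W r * (r * \<xi> (r\<^sup>2))) + (LINT r:{0..B}|lborel. decrement n F r * (r * \<xi> (r\<^sup>2)))) = 0"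
    unfolding lhs rhs sd distrib_left by linarith
  then have "(LINT r:{0..B}|lborel. W r * (r * \<xi> (r\<^sup>2))) + (LINT r:{0..B}|lborel. decrement n F r * (r * \<xi> (r\<^sup>2))) = 0"
    using K by simp
  moreover have "(LINT r:{0..B}|lborel. (W r + decrement n F r) * (r * \<xi> (r\<^sup>2)))
    = (LINT r:{0..B}|lborel. W r * (r * \<xi> (r\<^sup>2))) + (LINT r:{0..B}|lborel. decrement n F r * (r * \<xi> (r\<^sup>2)))"
    unfolding distrib_right
    by (intro set_integral_add set_integrable_locally_bounded locally_bounded_mult bdd locally_bounded_continuous[OF contm] locally_bounded_continuous[OF contd]
       borel_measurable_times borel_measurable_continuous_onI[OF contd]) auto
  ultimately show ?thesis by simp
qed

text \<open>Bumps approximating two intervals are compared; a factor makes the total mass vanish.\<close>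

lemma weighted_average_constant:
  fixes D :: "real \<Rightarrow> real"
  assumes [measurable]: "D \<in> borel_measurable borel" and D: "locally_bounded D"
    and zero: "\<And>\<xi> a b B. (\<And>j. continuously_differentiable j \<xi>) \<Longrightarrow> 0 < a \<Longrightarrow> a < b \<Longrightarrow>
      (\<And>t. t \<notin> {a<..<b} \<Longrightarrow> \<xi> t = 0) \<Longrightarrow> (\<integral>t. \<xi> t \<partial>lborel) = 0 \<Longrightarrow> 0 \<le> B \<Longrightarrow> b \<le> B\<^sup>2 \<Longrightarrow>
      (LINT r:{0..B}|lborel. D r * (r * \<xi> (r\<^sup>2))) = 0"
    and xy: "0 < x" "x < y"
  shows "(LINT r:{x<..<y}|lborel. D r * r) = (y\<^sup>2 - x\<^sup>2) * (LINT r:{1<..<sqrt 2}|lborel. D r * r)"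
proof -
  define B where "B = max y 2"
  define I where "I a b k = (LINT r:{0..B}|lborel. D r * (r * bump a b k (r\<^sup>2)))" for a b k
  define N where "N a b k = (\<integral>t. bump a b k t \<partial>lborel)" for a b k
  have [measurable]: "bump a b k \<in> borel_measurable borel" for a b k
    using continuously_differentiable_imp_continuous[OF continuously_differentiable_bump[of 0]]
    by (rule borel_measurable_continuous_onI)
  have bint: "integrable lborel (bump a b k)" for a b k
  proof (rule Bochner_Integration.integrable_bound[of _ "indicator {a..b}"])
    show "AE t in lborel. norm (bump a b k t) \<le> norm (indicator {a..b} t :: real)"
      by (intro AE_I2) (auto simp: indicator_def bump_range bump_outside)
  qed (auto simp: emeasure_lborel_Icc_eq)
  have Nlim: "N a b \<longlonglongrightarrow> b - a" if "a < b" for a b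
  proof -
    have "(\<lambda>k. \<integral>t. bump a b k t \<partial>lborel) \<longlonglongrightarrow> (\<integral>t. indicator {a<..<b} t \<partial>lborel)"
    proof (rule integral_dominated_convergence[where w = "indicator {a..b}"])
      show "AE t in lborel. norm (bump a b k t) \<le> indicator {a..b} t" for k
        by (intro AE_I2) (auto simp: indicator_def bump_range bump_outside)
    qed (auto simp: bump_tendsto emeasure_lborel_Icc_eq)
    then show ?thesis using that by (simp add: N_def[abs_def])
  qed
  have dint: "set_integrable lborel {0..B} (\<lambda>r. D r * (r * bump a b k (r\<^sup>2)))" for a b k
  proof -
    have "continuous_on UNIV (\<lambda>r. r * bump a b k (r\<^sup>2))"
      by (intro continuous_intros continuous_on_compose2[OF
          continuously_differentiable_imp_continuous[OF continuously_differentiable_bump[of 0]]]) auto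
    then show ?thesis
      by (intro set_integrable_locally_bounded locally_bounded_mult D locally_bounded_continuous) auto
  qed
  have Ilim: "I (a\<^sup>2) (b\<^sup>2) \<longlonglongrightarrow> (LINT r:{a<..<b}|lborel. D r * r)" if ab: "0 < a" "a < b" "b \<le> B" for a b
  proof -
    have "(\<lambda>k. \<integral>r. indicator {0..B} r *\<^sub>R (D r * (r * bump (a\<^sup>2) (b\<^sup>2) k (r\<^sup>2))) \<partial>lborel)
      \<longlonglongrightarrow> (\<integral>r. indicator {a<..<b} r *\<^sub>R (D r * r) \<partial>lborel)"
    proof (rule integral_dominated_convergence[where w = "\<lambda>r. \<bar>indicator {0..B} r *\<^sub>R (D r * r)\<bar>"])
      have "set_integrable lborel {0..B} (\<lambda>r. D r * r)"
        by (intro set_integrable_locally_bounded locally_bounded_mult D locally_bounded_continuous continuous_intros) auto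
      then show "integrable lborel (\<lambda>r. \<bar>indicator {0..B} r *\<^sub>R (D r * r)\<bar>)"
        unfolding set_integrable_def by (rule integrable_abs)
      show "AE r in lborel. norm (indicator {0..B} r *\<^sub>R (D r * (r * bump (a\<^sup>2) (b\<^sup>2) k (r\<^sup>2)))) \<le> \<bar>indicator {0..B} r *\<^sub>R (D r * r)\<bar>" for k
        using bump_range by (intro AE_I2) (auto simp: abs_mult indicator_def mult_left_le mult.assoc intro!: mult_left_mono)
      show "AE r in lborel. (\<lambda>k. indicator {0..B} r *\<^sub>R (D r * (r * bump (a\<^sup>2) (b\<^sup>2) k (r\<^sup>2)))) \<longlonglongrightarrow> indicator {a<..<b} r *\<^sub>R (D r * r)"
      proof (intro AE_I2)
        fix r
        have "(\<lambda>k. indicator {0..B} r *\<^sub>R (D r * (r * bump (a\<^sup>2) (b\<^sup>2) k (r\<^sup>2)))) \<longlonglongrightarrow> indicator {0..B} r *\<^sub>R (D r * (r * indicator {a\<^sup>2<..<b\<^sup>2} (r\<^sup>2)))"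
          by (intro tendsto_intros bump_tendsto)
        moreover have "indicator {0..B} r *\<^sub>R (D r * (r * indicator {a\<^sup>2<..<b\<^sup>2} (r\<^sup>2))) = indicator {a<..<b} r *\<^sub>R (D r * r)"
        proof (cases "0 \<le> r")
          case True
          then have "(a\<^sup>2 < r\<^sup>2) = (a < r)" "(r\<^sup>2 < b\<^sup>2) = (r < b)" using ab
            by (simp_all add: not_le[symmetric] power_mono_iff)
          then show ?thesis using True ab by (auto simp: indicator_def)
        next
          case False
          then show ?thesis using ab by (auto simp: indicator_def)
        qed
        ultimately show "(\<lambda>k. indicator {0..B} r *\<^sub>R (D r * (r * bump (a\<^sup>2) (b\<^sup>2) k (r\<^sup>2)))) \<longlonglongrightarrow> indicator {a<..<b} r *\<^sub>R (D r * r)"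
          by (simp only:)
      qed
    qed auto
    then show ?thesis by (simp add: I_def[abs_def] set_lebesgue_integral_def)
  qed
  have eq: "N 1 2 k * I (x\<^sup>2) (y\<^sup>2) k = N (x\<^sup>2) (y\<^sup>2) k * I 1 2 k" for k
  proof -
    define \<xi> where "\<xi> t = N 1 2 k * bump (x\<^sup>2) (y\<^sup>2) k t + (- N (x\<^sup>2) (y\<^sup>2) k) * bump 1 2 k t" for t
    have "(LINT r:{0..B}|lborel. D r * (r * \<xi> (r\<^sup>2))) = 0"
    proof (rule zero)
      show "continuously_differentiable j \<xi>" for j
        unfolding \<xi>_def[abs_def]
        by (intro continuously_differentiable_add continuously_differentiable_mult continuously_differentiable_const
            continuously_differentiable_bump)
      show "0 < min (x\<^sup>2) 1" using xy by simp
      show "min (x\<^sup>2) 1 < max (y\<^sup>2) 2" by (simp add: min_less_iff_disj less_max_iff_disj)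
      show "\<xi> t = 0" if "t \<notin> {min (x\<^sup>2) 1<..<max (y\<^sup>2) 2}" for t
      proof -
        have t: "t \<notin> {x\<^sup>2<..<y\<^sup>2}" "t \<notin> {1<..<2}"
          using that by (auto simp: min_less_iff_disj less_max_iff_disj)
        show ?thesis by (simp add: \<xi>_def bump_outside[OF t(1)] bump_outside[OF t(2)])
      qed
      show "(\<integral>t. \<xi> t \<partial>lborel) = 0"
        unfolding \<xi>_def by (subst Bochner_Integration.integral_add) (auto simp: bint N_def)
      show "0 \<le> B" by (simp add: B_def)
      show "max (y\<^sup>2) 2 \<le> B\<^sup>2"
        using xy power_mono[of y B 2] power_mono[of 2 B 2] by (simp add: B_def)
    qed
    moreover have "(LINT r:{0..B}|lborel. D r * (r * \<xi> (r\<^sup>2))) = N 1 2 k * I (x\<^sup>2) (y\<^sup>2) k + (- N (x\<^sup>2) (y\<^sup>2) k) * I 1 2 k"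
    proof -
      have "(LINT r:{0..B}|lborel. D r * (r * \<xi> (r\<^sup>2))) = (LINT r:{0..B}|lborel. N 1 2 k * (D r * (r * bump (x\<^sup>2) (y\<^sup>2) k (r\<^sup>2)))
          + (- N (x\<^sup>2) (y\<^sup>2) k) * (D r * (r * bump 1 2 k (r\<^sup>2))))"
        by (rule set_lebesgue_integral_cong) (auto simp: \<xi>_def algebra_simps)
      also have "\<dots> = N 1 2 k * I (x\<^sup>2) (y\<^sup>2) k + (- N (x\<^sup>2) (y\<^sup>2) k) * I 1 2 k"
        unfolding I_def using dint
        by (subst set_integral_add(2)) (simp_all only: set_integral_mult_right set_integrable_mult_right)
      finally show ?thesis .
    qed
    ultimately show ?thesis by simp
  qed
  have xy2: "x\<^sup>2 < y\<^sup>2" using xy by (intro power_strict_mono) auto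
  have "sqrt 2 \<le> 2" by (rule real_le_lsqrt) auto
  then have "I (1\<^sup>2) ((sqrt 2)\<^sup>2) \<longlonglongrightarrow> (LINT r:{1<..<sqrt 2}|lborel. D r * r)"
    by (intro Ilim) (auto simp: B_def)
  then have "(\<lambda>k. N (x\<^sup>2) (y\<^sup>2) k * I 1 2 k) \<longlonglongrightarrow> (y\<^sup>2 - x\<^sup>2) * (LINT r:{1<..<sqrt 2}|lborel. D r * r)"
    using xy2 by (intro tendsto_mult Nlim) auto
  moreover have "(\<lambda>k. N 1 2 k * I (x\<^sup>2) (y\<^sup>2) k) \<longlonglongrightarrow> (2 - 1) * (LINT r:{x<..<y}|lborel. D r * r)"
    using xy by (intro tendsto_mult Nlim Ilim) (auto simp: B_def)
  ultimately show ?thesis unfolding eq by (auto dest: LIMSEQ_unique)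
qed

text \<open>The weighted integrals of \<open>D\<close> grow like
  \<open>y\<^sup>2 - x\<^sup>2\<close>, exactly as those of a constant do; subtracting that constant
  leaves a function with zero integral over every interval.\<close>

lemma radial_representation:
  fixes w f :: "'a::euclidean_space \<Rightarrow> real" and W F :: "real \<Rightarrow> real"
  assumes weak: "neg_laplacian_eq w f"
    and w: "\<And>x. w x = W (norm x)" and f: "\<And>x. f x = F (norm x)"
    and [measurable]: "W \<in> borel_measurable borel" "F \<in> borel_measurable borel"
    and bdd: "locally_bounded W" "locally_bounded F"
  obtains c where "AE r in lborel. 0 < r \<longrightarrow> W r = c - decrement DIM('a) F r"
proof -
  define D where "D r = W r + decrement DIM('a) F r" for r
  have contd: "continuous_on UNIV (decrement DIM('a) F)" using bdd by (intro continuous_decrement) auto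
  have Dm [measurable]: "D \<in> borel_measurable borel" unfolding D_def[abs_def]
    by (intro borel_measurable_add borel_measurable_continuous_onI[OF contd]) auto
  have Db: "locally_bounded D" unfolding D_def[abs_def]
    by (intro locally_bounded_add bdd locally_bounded_continuous contd)
  \<comment> \<open>The factor 2 is forced by the integral of \<open>r\<close> from 1 to
    \<open>sqrt 2\<close>, which is 1/2.\<close>
  define c where "c = 2 * (LINT r:{1<..<sqrt 2}|lborel. D r * r)"
  have avg: "(LINT r:{x<..<y}|lborel. D r * r) = (y\<^sup>2 - x\<^sup>2) * (LINT r:{1<..<sqrt 2}|lborel. D r * r)"
    if "0 < x" "x < y" for x y
    using weak_radial_equation[OF weak w f _ _ bdd] that
    by (intro weighted_average_constant Dm Db) (auto simp: D_def)
  have "AE r in lborel. 0 < r \<longrightarrow> (D r - c) * r = 0"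
  proof (rule AE_zero_of_interval_integrals)
    have int: "set_integrable lborel {x<..<y} (\<lambda>r. E r * r)" if "E \<in> borel_measurable borel" "locally_bounded E" for E x y
      using that by (intro set_integrable_locally_bounded locally_bounded_mult that locally_bounded_continuous[OF continuous_on_id]) auto
    have cb: "locally_bounded (\<lambda>_. k)" for k by (intro locally_bounded_continuous continuous_intros)
    show "locally_bounded (\<lambda>r. (D r - c) * r)"
      using locally_bounded_mult[OF locally_bounded_add[OF Db cb[of "- c"]] locally_bounded_continuous[OF continuous_on_id]] by simp
    fix x y :: real assume xy: "0 < x" "x < y"
    have cr: "(LINT r:{x<..<y}|lborel. c * r) = c * (y\<^sup>2 - x\<^sup>2) / 2"
    proof -
      have "(LINT r:{x<..<y}|lborel. c * r) = (\<integral>r. (c * r) * indicator {x..y} r \<partial>lborel)"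
        unfolding set_lebesgue_integral_def
        by (rule integral_cong_AE) (use AE_lborel_singleton[of x] AE_lborel_singleton[of y] in
            \<open>auto elim!: eventually_elim2 simp: indicator_def\<close>)
      also have "\<dots> = c * y\<^sup>2 / 2 - c * x\<^sup>2 / 2"
        by (rule integral_FTC_Icc_real) (use xy in \<open>auto intro!: derivative_eq_intros continuous_intros\<close>)
      finally show ?thesis by (simp add: algebra_simps diff_divide_distrib)
    qed
    have diff: "(LINT r:{x<..<y}|lborel. (D r - c) * r) = (LINT r:{x<..<y}|lborel. D r * r) - (LINT r:{x<..<y}|lborel. c * r)"
      unfolding left_diff_distrib by (intro set_integral_diff int Dm Db cb) auto
    show "(LINT r:{x<..<y}|lborel. (D r - c) * r) = 0"
      unfolding diff cr avg[OF xy] by (simp add: c_def)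
  qed auto
  then have "AE r in lborel. 0 < r \<longrightarrow> W r = c - decrement DIM('a) F r"
    by eventually_elim (auto simp: D_def)
  then show ?thesis by (rule that)
qed

subsection \<open>Asymptotics of positive radial profiles\<close>

text \<open>Minus the derivative of \<open>ln f\<close> with respect to \<open>ln r\<close>, that
  is, the local decay exponent.\<close>

definition log_slope :: "(real \<Rightarrow> real) \<Rightarrow> (real \<Rightarrow> real) \<Rightarrow> real \<Rightarrow> real" where
  "log_slope f f' r = - (r * f' r / f r)"

definition source_ratio :: "real \<Rightarrow> (real \<Rightarrow> real) \<Rightarrow> (real \<Rightarrow> real) \<Rightarrow> real \<Rightarrow> real" where
  "source_ratio a g f r = r\<^sup>2 * g r powr a / f r"

text \<open>Meant for differential inequalities valid only while \<open>c \<le> f\<close>: going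
  back from \<open>b\<close>, the regime either lasts to \<open>a\<close> or starts at a point with
  \<open>f s = c\<close>. That point is the largest element of the compact set where
  \<open>f \<le> c\<close>.\<close>

lemma last_entry:
  fixes f :: "real \<Rightarrow> real"
  assumes "a \<le> b" "continuous_on {a..b} f" "c < f b"
  obtains "\<forall>x\<in>{a..b}. c \<le> f x"
  | s where "a \<le> s" "s < b" "f s = c" "\<forall>x\<in>{s..b}. c \<le> f x"
proof (cases "\<forall>x\<in>{a..b}. c \<le> f x")
  case True
  then show ?thesis using that by blast
next
  case False
  define S where "S = {x\<in>{a..b}. f x \<le> c}"
  have "S \<noteq> {}" using False unfolding S_def by force
  moreover have "closed S" unfolding S_def
    by (intro continuous_on_closed_Collect_le assms continuous_intros)
  moreover have "bounded S" by (rule bounded_subset[of "{a..b}"]) (auto simp: S_def)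
  ultimately have "compact S" "S \<noteq> {}" by (auto simp: compact_eq_bounded_closed)
  then obtain s where s: "s \<in> S" "\<And>t. t \<in> S \<Longrightarrow> t \<le> s" using compact_attains_sup by metis
  have sb: "a \<le> s" "s < b" "f s \<le> c" using s(1) assms(3) unfolding S_def
    by (auto simp: less_le)
  have gt: "c < f x" if "x \<in> {s<..b}" for x
    using s(2)[of x] that sb unfolding S_def by force
  have "f s = c"
  proof (rule ccontr)
    assume "f s \<noteq> c"
    then have "f s < c" using sb by simp
    moreover have "continuous_on {s..b} f" using assms(2) sb by (auto intro: continuous_on_subset)
    ultimately obtain t where "s \<le> t" "t \<le> b" "f t = c"
      using IVT'[of f s c b] sb assms by auto
    then show False using gt[of t] \<open>f s < c\<close> by (cases "t = s") auto
  qed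
  moreover have "c \<le> f x" if "x \<in> {s..b}" for x
    using gt[of x] that \<open>f s = c\<close> by (cases "x = s") auto
  ultimately show ?thesis using that(2)[of s] sb by blast
qed

text \<open>Adapted to derivatives with respect to \<open>ln r\<close>, whose sign is that of the
  numerator.\<close>

lemma nondecreasing_from_deriv:
  fixes f :: "real \<Rightarrow> real"
  assumes "a \<le> b" "\<And>x. x \<in> {a..b} \<Longrightarrow> (f has_real_derivative f' x / x) (at x)"
    "\<And>x. x \<in> {a..b} \<Longrightarrow> 0 \<le> f' x" "0 < a"
  shows "f a \<le> f b"
  using assms(1)
proof (rule DERIV_nonneg_imp_nondecreasing)
  fix x assume "a \<le> x" "x \<le> b"
  then show "\<exists>y. DERIV f x :> y \<and> 0 \<le> y"
    using assms(2)[of x] assms(3)[of x] assms(4) by (intro exI[of _ "f' x / x"]) auto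
qed

text \<open>Here \<open>m + 2\<close> is the dimension, by which the supercritical condition has
  been multiplied. The limits at 0 are there to make the Pohozaev energy vanish at the
  origin.\<close>

locale radial_lane_emden =
  fixes U V U' V' :: "real \<Rightarrow> real" and U0 V0 p q m :: real
  assumes p_pos: "0 < p" and q_pos: "0 < q" and m_ge: "1 \<le> m"
    and supercritical: "(m + 2) / (p + 1) + (m + 2) / (q + 1) < m"
    and U_pos: "\<And>r. 0 < r \<Longrightarrow> 0 < U r" and V_pos: "\<And>r. 0 < r \<Longrightarrow> 0 < V r"
    and U'_nonpos: "\<And>r. 0 < r \<Longrightarrow> U' r \<le> 0" and V'_nonpos: "\<And>r. 0 < r \<Longrightarrow> V' r \<le> 0"
    and DU: "\<And>r. 0 < r \<Longrightarrow> (U has_real_derivative U' r) (at r)"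
    and DV: "\<And>r. 0 < r \<Longrightarrow> (V has_real_derivative V' r) (at r)"
    and DU': "\<And>r. 0 < r \<Longrightarrow> (U' has_real_derivative - (V r powr p) - (m + 1) / r * U' r) (at r)"
    and DV': "\<And>r. 0 < r \<Longrightarrow> (V' has_real_derivative - (U r powr q) - (m + 1) / r * V' r) (at r)"
    and U_lim: "(U \<longlongrightarrow> U0) (at_right 0)" and V_lim: "(V \<longlongrightarrow> V0) (at_right 0)"
    and U'_lim: "(U' \<longlongrightarrow> 0) (at_right 0)" and V'_lim: "(V' \<longlongrightarrow> 0) (at_right 0)"
begin

lemma swap: "radial_lane_emden V U V' U' V0 U0 q p m"
  using p_pos q_pos m_ge supercritical U_pos V_pos U'_nonpos V'_nonpos DU DV DU' DV' U_lim V_lim U'_lim V'_lim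
  by unfold_locales (auto simp: add.commute)

section \<open>The quadratic system and its one-sided bounds\<close>

abbreviation "P \<equiv> log_slope U U'"
abbreviation "Q \<equiv> log_slope V V'"
abbreviation "lam \<equiv> source_ratio p V U"
abbreviation "mu \<equiv> source_ratio q U V"

lemma P_nonneg: "0 < r \<Longrightarrow> 0 \<le> P r"
  using U_pos[of r] U'_nonpos[of r] by (simp add: log_slope_def divide_nonpos_pos mult_nonneg_nonpos)

lemma lam_pos: "0 < r \<Longrightarrow> 0 < lam r"
  using U_pos[of r] V_pos[of r] by (simp add: source_ratio_def)

lemma U'_eq: "0 < r \<Longrightarrow> U' r = - P r * U r / r"
  using U_pos[of r] by (simp add: log_slope_def)

lemma V'_eq: "0 < r \<Longrightarrow> V' r = - Q r * V r / r"
  using V_pos[of r] by (simp add: log_slope_def)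

lemma powr_eq: "0 < r \<Longrightarrow> V r powr p = lam r * U r / r\<^sup>2"
  using U_pos[of r] by (simp add: source_ratio_def)

lemma DP:
  assumes r: "0 < r"
  shows "(P has_real_derivative ((P r)\<^sup>2 - m * P r + lam r) / r) (at r)"
proof -
  have "(P has_real_derivative
     - (((1 * U' r + (- (V r powr p) - (m + 1) / r * U' r) * r) * U r - r * U' r * U' r) / (U r * U r))) (at r)"
    unfolding log_slope_def using U_pos[OF r]
    by (intro DERIV_minus DERIV_divide DERIV_mult DERIV_ident DU DU' r) auto
  moreover have "- (((1 * U' r + (- (V r powr p) - (m + 1) / r * U' r) * r) * U r - r * U' r * U' r) / (U r * U r))
    = ((P r)\<^sup>2 - m * P r + lam r) / r"
    using U_pos[OF r] r unfolding U'_eq[OF r] powr_eq[OF r]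
    by (simp add: field_simps power2_eq_square)
  ultimately show ?thesis by simp
qed

lemma Dlam:
  assumes r: "0 < r"
  shows "(lam has_real_derivative lam r * (2 + P r - p * Q r) / r) (at r)"
proof -
  have "((\<lambda>x. V x powr p) has_real_derivative p * V r powr (p - 1) * V' r) (at r)"
    using DERIV_fun_powr[OF DV[OF r] V_pos[OF r], of p] by simp
  moreover have "V r powr (p - 1) = V r powr p / V r"
    using V_pos[OF r] by (simp add: powr_diff)
  ultimately have d: "((\<lambda>x. V x powr p) has_real_derivative - (p * Q r / r * V r powr p)) (at r)"
    using V_pos[OF r] r by (simp add: V'_eq mult_ac)
  have "(lam has_real_derivative
     ((2 * r * V r powr p + - (p * Q r / r * V r powr p) * r\<^sup>2) * U r - r\<^sup>2 * V r powr p * U' r) / (U r * U r)) (at r)"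
    unfolding source_ratio_def using U_pos[OF r]
    by (intro DERIV_divide DERIV_mult d DU r) (auto intro!: derivative_eq_intros)
  moreover have "((2 * r * V r powr p + - (p * Q r / r * V r powr p) * r\<^sup>2) * U r - r\<^sup>2 * V r powr p * U' r) / (U r * U r)
     = lam r * (2 + P r - p * Q r) / r"
    using U_pos[OF r] r unfolding U'_eq[OF r] powr_eq[OF r]
    by (simp add: field_simps power2_eq_square)
  ultimately show ?thesis by simp
qed

lemma Dln_lam:
  assumes r: "0 < r"
  shows "((\<lambda>x. ln (lam x)) has_real_derivative (2 + P r - p * Q r) / r) (at r)"
  using DERIV_chain'[OF Dlam[OF r] DERIV_ln_divide[OF lam_pos[OF r]]] lam_pos[OF r] by simp

text \<open>The function equals \<open>(m - P x) * U x\<close> and, up to the factor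
  \<open>x powr (m - 1)\<close>, the derivative of \<open>x powr m * U x\<close>. It is
  nonincreasing; this controls both the bound \<open>P \<le> m\<close> and the Harnack
  estimate.\<close>

lemma DT:
  assumes r: "0 < r"
  shows "((\<lambda>x. x * U' x + m * U x) has_real_derivative - (r * V r powr p)) (at r)"
proof -
  have "((\<lambda>x. x * U' x + m * U x) has_real_derivative
      (1 * U' r + (- (V r powr p) - (m + 1) / r * U' r) * r) + m * U' r) (at r)"
    by (intro DERIV_add DERIV_mult DERIV_cmult DERIV_ident DU DU' r)
  moreover have "(1 * U' r + (- (V r powr p) - (m + 1) / r * U' r) * r) + m * U' r = - (r * V r powr p)"
    using r by (simp add: field_simps)
  ultimately show ?thesis by simp
qed

lemma D_weighted_U:
  assumes r: "0 < r"
  shows "((\<lambda>x. x powr m * U x) has_real_derivative r powr (m - 1) * (r * U' r + m * U r)) (at r)"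
proof -
  have "((\<lambda>x. x powr m * U x) has_real_derivative (m * r powr (m - 1)) * U r + U' r * r powr m) (at r)"
    by (intro DERIV_mult DU r has_real_derivative_powr)
  moreover have "r powr m = r powr (m - 1) * r" using r by (simp add: powr_diff)
  ultimately show ?thesis by (simp add: algebra_simps)
qed

lemma T_antimono:
  assumes "0 < r" "r \<le> t"
  shows "t * U' t + m * U t \<le> r * U' r + m * U r"
proof (rule DERIV_nonpos_imp_nonincreasing[OF assms(2)])
  fix x assume "r \<le> x" "x \<le> t"
  then show "\<exists>y. DERIV (\<lambda>x. x * U' x + m * U x) x :> y \<and> y \<le> 0"
    using DT[of x] assms(1) by (intro exI[of _ "- (x * V x powr p)"]) auto
qed

text \<open>If \<open>r U' + m U\<close> became negative it would stay below a negative constant, which makes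
  \<open>r\<^sup>m U\<close> tend to \<open>-\<infinity>\<close>.\<close>

lemma T_nonneg:
  assumes r: "0 < r"
  shows "0 \<le> r * U' r + m * U r"
proof (rule ccontr)
  define c where "c = - (r * U' r + m * U r)"
  define f where "f x = x powr m * U x + (c * r powr (m - 1)) * x" for x
  assume "\<not> ?thesis"
  then have c: "0 < c" by (simp add: c_def)
  define k where "k = c * r powr (m - 1)"
  have k: "0 < k" using c r by (simp add: k_def)
  \<comment> \<open>At this point the linear loss \<open>k * (t - r)\<close> has used up all of
    \<open>r powr m * U r\<close>, so \<open>t powr m * U t\<close> could no longer be
    positive.\<close>
  define t where "t = r + (r powr m * U r) / k"
  have tr: "r \<le> t" unfolding t_def using k r U_pos[OF r] by simp
  have "f t \<le> f r"
  proof (rule DERIV_nonpos_imp_nonincreasing[OF tr])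
    fix x assume x: "r \<le> x" "x \<le> t"
    then have x0: "0 < x" using r by simp
    have "(f has_real_derivative x powr (m - 1) * (x * U' x + m * U x) + c * r powr (m - 1)) (at x)"
      unfolding f_def using DERIV_add[OF D_weighted_U[OF x0] DERIV_cmult[OF DERIV_ident]]
      by simp
    moreover have "x powr (m - 1) * (x * U' x + m * U x) \<le> r powr (m - 1) * (- c)"
    proof -
      have a: "x * U' x + m * U x \<le> - c" using T_antimono[OF r x(1)] by (simp add: c_def)
      have b: "r powr (m - 1) \<le> x powr (m - 1)" using r x m_ge by (intro powr_mono2) auto
      have "x powr (m - 1) * (x * U' x + m * U x) \<le> x powr (m - 1) * (- c)"
        using a by (intro mult_left_mono) auto
      also have "\<dots> \<le> r powr (m - 1) * (- c)" using b c by (intro mult_right_mono_neg) auto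
      finally show ?thesis .
    qed
    ultimately show "\<exists>y. DERIV f x :> y \<and> y \<le> 0" by (force simp: mult.commute)
  qed
  moreover have "0 < t powr m * U t" using U_pos[of t] tr r by simp
  moreover have "k * t = k * r + r powr m * U r" unfolding t_def using k by (simp add: field_simps)
  ultimately show False unfolding f_def k_def[symmetric] by simp
qed

text \<open>Since \<open>x powr m * U x\<close> is nondecreasing, doubling the radius costs at most
  the factor \<open>2 powr m\<close>.\<close>

lemma U_doubling:
  assumes r: "0 < r"
  shows "2 powr (- m) * U r \<le> U (2 * r)"
proof -
  have "r powr m * U r \<le> (2 * r) powr m * U (2 * r)"
  proof (rule DERIV_nonneg_imp_nondecreasing[where f = "\<lambda>x. x powr m * U x"])
    show "r \<le> 2 * r" using r by simp
    fix x assume "r \<le> x" "x \<le> 2 * r"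
    then have "0 < x" using r by simp
    then show "\<exists>y. DERIV (\<lambda>x. x powr m * U x) x :> y \<and> 0 \<le> y"
      using D_weighted_U T_nonneg by (intro exI[of _ "x powr (m - 1) * (x * U' x + m * U x)"]) simp
  qed
  then have "U r \<le> 2 powr m * U (2 * r)" using r by (simp add: powr_mult)
  then show ?thesis by (simp add: powr_minus field_simps)
qed

lemma U_antimono:
  assumes "0 < r" "r \<le> t"
  shows "U t \<le> U r"
proof (rule DERIV_nonpos_imp_nonincreasing[OF assms(2)])
  fix x assume "r \<le> x" "x \<le> t"
  then show "\<exists>y. DERIV U x :> y \<and> y \<le> 0"
    using DU[of x] U'_nonpos[of x] assms(1) by auto
qed

end

section \<open>The Harnack estimate and the Pohozaev quantity\<close>

context radial_lane_emden
begin

interpretation s: radial_lane_emden V U V' U' V0 U0 q p m by (rule swap)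

text \<open>Between \<open>r\<close> and \<open>2 * r\<close> the nonnegative quantity
  \<open>(m - P) U\<close> drops by \<open>r * z * V z powr p\<close> for some intermediate
  \<open>z\<close>, so its value at \<open>r\<close> is at least that. Doubling for \<open>V\<close>
  compares \<open>V z\<close> with \<open>V r\<close>, whence the constant
  \<open>2 powr (- m * p)\<close>.\<close>

lemma slope_gap:
  assumes r: "0 < r"
  shows "2 powr (- m * p) * lam r \<le> m - P r"
proof -
  let ?T = "\<lambda>x. x * U' x + m * U x"
  have "\<exists>z. r < z \<and> z < 2 * r \<and> ?T (2 * r) - ?T r = (2 * r - r) * - (z * V z powr p)"
    using r DT by (intro MVT2) auto
  then obtain z where z: "r < z" "z < 2 * r" "?T (2 * r) - ?T r = (2 * r - r) * - (z * V z powr p)"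
    by blast
  have "(2 powr (- m) * V r) powr p \<le> V z powr p"
  proof (rule powr_mono2)
    show "2 powr (- m) * V r \<le> V z"
      using s.U_doubling[OF r] s.U_antimono[of z "2 * r"] z r by simp
  qed (use p_pos V_pos[OF r] in auto)
  then have 1: "2 powr (- m * p) * V r powr p \<le> V z powr p"
    using V_pos[OF r] by (simp add: powr_mult powr_powr)
  have "r * (r * (2 powr (- m * p) * V r powr p)) \<le> r * (z * V z powr p)"
    using z r 1 by (intro mult_left_mono mult_mono) auto
  also have "\<dots> = ?T r - ?T (2 * r)" using z(3) by simp
  also have "\<dots> \<le> ?T r" using T_nonneg[of "2 * r"] r by simp
  also have "\<dots> = (m - P r) * U r" using U_pos[OF r] r by (simp add: U'_eq algebra_simps)
  finally have "2 powr (- m * p) * (lam r * U r) \<le> (m - P r) * U r"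
    using r by (simp add: powr_eq power2_eq_square)
  then show ?thesis using U_pos[OF r] by (simp add: mult.assoc[symmetric])
qed

lemma P_le: "0 < r \<Longrightarrow> P r \<le> m"
  using slope_gap[of r] lam_pos[of r] by (smt (verit) mult_nonneg_nonneg powr_ge_zero)

lemma lam_le: "0 < r \<Longrightarrow> lam r \<le> m * 2 powr (m * p)"
proof -
  assume r: "0 < r"
  then have "2 powr (- m * p) * lam r \<le> m" using slope_gap[OF r] P_nonneg[OF r] by simp
  then show ?thesis by (simp add: powr_minus field_simps)
qed

text \<open>The weights \<open>thU\<close> and \<open>thV\<close> are the multipliers of the
  Pohozaev identity: with them the potential terms \<open>U powr (q + 1)\<close> and
  \<open>V powr (p + 1)\<close> cancel in the derivative of the energy, and \<open>gap\<close>
  remains as the coefficient of \<open>P * Q\<close>.\<close>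

definition "thU = (m + 2) / (q + 1)"
definition "thV = (m + 2) / (p + 1)"
definition "gap = m - thU - thV"

lemma gap_pos: "0 < gap" using supercritical by (simp add: gap_def thU_def thV_def)
lemma th_pos: "0 < thU" "0 < thV" using p_pos q_pos m_ge by (auto simp: thU_def thV_def)

definition "K r = thU * Q r + thV * P r - P r * Q r - mu r / (q + 1) - lam r / (p + 1)"

lemma DK:
  assumes r: "0 < r"
  shows "(K has_real_derivative (K r * (P r + Q r - m) + gap * P r * Q r) / r) (at r)"
proof -
  let ?P1 = "((P r)\<^sup>2 - m * P r + lam r) / r" and ?Q1 = "((Q r)\<^sup>2 - m * Q r + mu r) / r"
  let ?l1 = "lam r * (2 + P r - p * Q r) / r" and ?m1 = "mu r * (2 + Q r - q * P r) / r"
  have "(K has_real_derivative thU * ?Q1 + thV * ?P1 - (?P1 * Q r + ?Q1 * P r) - ?m1 / (q + 1) - ?l1 / (p + 1)) (at r)"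
    unfolding K_def
    by (intro DERIV_diff DERIV_add DERIV_cmult DERIV_mult DERIV_cdivide DP Dlam s.DP s.Dlam r)
  moreover have "thU * ?Q1 + thV * ?P1 - (?P1 * Q r + ?Q1 * P r) - ?m1 / (q + 1) - ?l1 / (p + 1)
    = (K r * (P r + Q r - m) + gap * P r * Q r) / r"
  proof -
    have q1: "q + 1 \<noteq> 0" "p + 1 \<noteq> 0" using p_pos q_pos by auto
    \<comment> \<open>With \<open>a * q = 1 - a\<close> and \<open>b * p = 1 - b\<close> the claim
      becomes a polynomial identity.\<close>
    define a where "a = 1 / (q + 1)"
    define b where "b = 1 / (p + 1)"
    have ab: "a * q = 1 - a" "b * p = 1 - b" using q1 by (auto simp: a_def b_def field_simps)
    have th: "thU = (m + 2) * a" "thV = (m + 2) * b" by (auto simp: thU_def thV_def a_def b_def)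
    have dv: "x / (q + 1) = x * a" "x / (p + 1) = x * b" for x by (auto simp: a_def b_def)
    have "thU * ((Q r)\<^sup>2 - m * Q r + mu r) + thV * ((P r)\<^sup>2 - m * P r + lam r)
      - (((P r)\<^sup>2 - m * P r + lam r) * Q r + ((Q r)\<^sup>2 - m * Q r + mu r) * P r)
      - mu r * ((2 + Q r) * a - (a * q) * P r) - lam r * ((2 + P r) * b - (b * p) * Q r)
      = K r * (P r + Q r - m) + gap * P r * Q r"
      unfolding ab K_def gap_def dv th by (simp add: algebra_simps power2_eq_square)
    then have "(K r * (P r + Q r - m) + gap * P r * Q r) / r = (thU * ((Q r)\<^sup>2 - m * Q r + mu r) + thV * ((P r)\<^sup>2 - m * P r + lam r)
      - (((P r)\<^sup>2 - m * P r + lam r) * Q r + ((Q r)\<^sup>2 - m * Q r + mu r) * P r)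
      - mu r * ((2 + Q r) * a - (a * q) * P r) - lam r * ((2 + P r) * b - (b * p) * Q r)) * (1 / r)"
      by simp
    then show ?thesis unfolding dv by (simp add: algebra_simps diff_divide_distrib add_divide_distrib)
  qed
  ultimately show ?thesis by simp
qed

text \<open>Up to sign, \<open>r\<^sup>m U V K\<close> is the Pohozaev energy for which the derivative involves only \<open>U' V'\<close>.\<close>

lemma K_nonneg:
  assumes r: "0 < r"
  shows "0 \<le> K r"
proof -
  define E where "E x = x powr m * U x * V x * K x" for x
  \<comment> \<open>The logarithmic derivative of \<open>x powr m * U x * V x\<close> is
    \<open>(m - P x - Q x) / x\<close>; this integrating factor removes the term of
    \<open>DK\<close> that is linear in \<open>K\<close>.\<close>
  have DE: "(E has_real_derivative x powr m * U x * V x * (gap * P x * Q x) / x) (at x)" if x: "0 < x" for x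
  proof -
    have "((\<lambda>x. x powr m) has_real_derivative m * x powr (m - 1)) (at x)"
      by (intro has_real_derivative_powr x)
    moreover have "x powr (m - 1) = x powr m / x" using x by (simp add: powr_diff)
    ultimately have a: "((\<lambda>x. x powr m) has_real_derivative m * x powr m / x) (at x)" by simp
    have "(E has_real_derivative (((m * x powr m / x) * U x + U' x * x powr m) * V x + V' x * (x powr m * U x)) * K x
        + (K x * (P x + Q x - m) + gap * P x * Q x) / x * (x powr m * U x * V x)) (at x)"
      unfolding E_def by (intro DERIV_mult a DU DV DK x)
    moreover have "(((m * x powr m / x) * U x + U' x * x powr m) * V x + V' x * (x powr m * U x)) * K x
        + (K x * (P x + Q x - m) + gap * P x * Q x) / x * (x powr m * U x * V x)
        = x powr m * U x * V x * (gap * P x * Q x) / x"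
      using x by (simp add: U'_eq V'_eq field_simps)
    ultimately show ?thesis by simp
  qed
  have mono: "E x \<le> E r" if x: "0 < x" "x \<le> r" for x
  proof (rule nondecreasing_from_deriv[OF x(2) _ _ x(1)])
    fix y assume "y \<in> {x..r}"
    then have y: "0 < y" using x by simp
    show "(E has_real_derivative y powr m * U y * V y * (gap * P y * Q y) / y) (at y)" by (rule DE[OF y])
    show "0 \<le> y powr m * U y * V y * (gap * P y * Q y)"
      using y U_pos[OF y] V_pos[OF y] P_nonneg[OF y] s.P_nonneg[OF y] gap_pos by simp
  qed
  \<comment> \<open>The energy rewritten without division by \<open>U\<close> or \<open>V\<close>,
    so that its limit at 0 can be taken termwise even if \<open>U0\<close> or \<open>V0\<close> is
    0.\<close>
  define G where "G x = x powr m * (- (thU * x * U x * V' x) - thV * x * U' x * V x - x\<^sup>2 * U' x * V' x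
      - x\<^sup>2 * (U x powr q * U x) / (q + 1) - x\<^sup>2 * (V x powr p * V x) / (p + 1))" for x
  have EG: "E x = G x" if x: "0 < x" for x
    using x unfolding E_def G_def K_def powr_eq[OF x] s.powr_eq[OF x] U'_eq[OF x] V'_eq[OF x]
    by (simp add: algebra_simps power2_eq_square)
  have pw: "((\<lambda>x::real. x powr m) \<longlongrightarrow> 0) (at_right 0)"
  proof -
    have "((\<lambda>x::real. x powr m) \<longlongrightarrow> 0 powr m) (at_right 0)"
      using m_ge by (intro tendsto_powr') (auto simp: eventually_at_right_less intro: tendsto_intros
          eventually_at_rightI[of 0 1])
    then show ?thesis using m_ge by simp
  qed
  have Uq: "((\<lambda>x. U x powr q) \<longlongrightarrow> U0 powr q) (at_right 0)"
  proof (rule tendsto_powr'[OF U_lim tendsto_const])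
    have "eventually (\<lambda>x. 0 \<le> U x) (at_right 0)"
      by (rule eventually_at_rightI[of 0 1]) (simp_all add: U_pos less_imp_le)
    then show "U0 \<noteq> 0 \<or> 0 < q \<and> eventually (\<lambda>x. 0 \<le> U x) (at_right 0)" using q_pos by simp
  qed
  have Vp: "((\<lambda>x. V x powr p) \<longlongrightarrow> V0 powr p) (at_right 0)"
  proof (rule tendsto_powr'[OF V_lim tendsto_const])
    have "eventually (\<lambda>x. 0 \<le> V x) (at_right 0)"
      by (rule eventually_at_rightI[of 0 1]) (simp_all add: V_pos less_imp_le)
    then show "V0 \<noteq> 0 \<or> 0 < p \<and> eventually (\<lambda>x. 0 \<le> V x) (at_right 0)" using p_pos by simp
  qed
  have "(G \<longlongrightarrow> 0 * (- (thU * 0 * U0 * 0) - thV * 0 * 0 * V0 - 0\<^sup>2 * 0 * 0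
      - 0\<^sup>2 * (U0 powr q * U0) / (q + 1) - 0\<^sup>2 * (V0 powr p * V0) / (p + 1))) (at_right 0)"
    unfolding G_def using p_pos q_pos
    by (intro tendsto_mult tendsto_diff tendsto_minus tendsto_divide tendsto_power pw Uq Vp U_lim V_lim U'_lim V'_lim
        tendsto_const tendsto_ident_at) auto
  then have "(G \<longlongrightarrow> 0) (at_right 0)" by simp
  moreover have "eventually (\<lambda>x. G x \<le> E r) (at_right 0)"
    using mono EG r by (intro eventually_at_rightI[of 0 r]) auto
  ultimately have "0 \<le> E r" by (intro tendsto_upperbound) auto
  then show ?thesis unfolding E_def using mult_pos_pos[OF mult_pos_pos[OF _ U_pos[OF r]] V_pos[OF r], of "r powr m"] r
    by (simp add: zero_le_mult_iff)
qed

end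

section \<open>Distance from the fast decay rate\<close>

context radial_lane_emden
begin

interpretation s: radial_lane_emden V U V' U' V0 U0 q p m by (rule swap)

lemma K_le: assumes r: "0 < r" shows "K r \<le> m\<^sup>2"
proof -
  have "K r \<le> thU * Q r + thV * P r"
    unfolding K_def using lam_pos[OF r] s.lam_pos[OF r] P_nonneg[OF r] s.P_nonneg[OF r] p_pos q_pos
    by (smt (verit) divide_pos_pos mult_nonneg_nonneg)
  also have "\<dots> \<le> thU * m + thV * m"
    using th_pos P_le[OF r] s.P_le[OF r] by (intro add_mono mult_left_mono) auto
  also have "\<dots> \<le> m\<^sup>2" using gap_pos m_ge unfolding gap_def power2_eq_square
    by (simp add: distrib_right[symmetric])
  finally show ?thesis .
qed

text \<open>While \<open>P\<close> is close to its maximal value \<open>m\<close>, the integral of \<open>Q\<close> is controlled by the growth of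
  \<open>K\<close>; hence \<open>lam\<close>, which is not small when that regime is entered, stays bounded below.\<close>

lemma P_bounded_away: "\<exists>d>0. \<forall>r\<ge>1. P r \<le> m - d"
proof -
  \<comment> \<open>Chosen so that \<open>c * gap * (m / 2) = p\<close>: where
    \<open>P \<ge> m / 2\<close>, the growth of \<open>c * K\<close> pays for the term
    \<open>- p * Q\<close> in the derivative of \<open>ln lam\<close>.\<close>
  define c where "c = 2 * p / (gap * m)"
  have c: "0 < c" using p_pos gap_pos m_ge by (simp add: c_def)
  \<comment> \<open>The first bound ensures \<open>P \<ge> m / 2\<close> in the regime
    \<open>P \<ge> m - e\<close>. The second keeps the loss from \<open>c * K * (P + Q - m)\<close>
    below 1, against the constant 2 in the equation of \<open>lam\<close>.\<close>
  define e where "e = min (m / 2) (1 / (c * m\<^sup>2))"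
  have e: "0 < e" "e \<le> m / 2" "c * (e * m\<^sup>2) \<le> 1"
  proof -
    show "0 < e" "e \<le> m / 2" using c m_ge by (auto simp: e_def)
    have "e \<le> 1 / (c * m\<^sup>2)" by (simp add: e_def)
    moreover have "0 < c * m\<^sup>2" using c m_ge by simp
    ultimately have "e * (c * m\<^sup>2) \<le> 1" by (simp add: pos_le_divide_eq)
    then show "c * (e * m\<^sup>2) \<le> 1" by (simp add: mult_ac)
  qed
  define L where "L x = ln (lam x) + c * K x" for x
  \<comment> \<open>The two logarithms are the possible starting values of \<open>ln lam\<close>, at
    \<open>r = 1\<close> or at a later entry; \<open>c * m\<^sup>2\<close> bounds the correction, as
    \<open>0 \<le> K \<le> m\<^sup>2\<close>.\<close>
  define l0 where "l0 = min (ln (lam 1)) (ln (e * (m / 2))) - c * m\<^sup>2"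
  define d where "d = min e (2 powr (- m * p) * exp l0)"
  have d: "0 < d" using e by (simp add: d_def)
  have "P r \<le> m - d" if r1: "1 \<le> r" for r
  proof (cases "P r \<le> m - e")
    case True
    then show ?thesis by (simp add: d_def)
  next
    case False
    have r: "0 < r" using r1 by simp
    have incr: "L x \<le> L r" if x: "1 \<le> x" "x \<le> r" and ge: "\<forall>y\<in>{x..r}. m - e \<le> P y" for x
    proof (rule nondecreasing_from_deriv[OF x(2)])
      fix y assume y: "y \<in> {x..r}"
      then have y0: "0 < y" using x by simp
      show "(L has_real_derivative ((2 + P y - p * Q y) + c * (K y * (P y + Q y - m) + gap * P y * Q y)) / y) (at y)"
        unfolding L_def
        by (rule DERIV_cong[OF DERIV_add[OF Dln_lam[OF y0] DERIV_cmult[OF DK[OF y0], of c]]])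
          (simp add: add_divide_distrib distrib_left)
      have Pe: "m - e \<le> P y" using ge y by blast
      have Q0: "0 \<le> Q y" by (rule s.P_nonneg[OF y0])
      have "K y * (- e) \<le> K y * (P y + Q y - m)"
        using K_nonneg[OF y0] Pe Q0 by (intro mult_left_mono) auto
      moreover have "K y * e \<le> m\<^sup>2 * e" using K_le[OF y0] e by (intro mult_right_mono) auto
      moreover have "gap * (m / 2) * Q y \<le> gap * P y * Q y"
        using Pe e gap_pos Q0 by (intro mult_right_mono mult_left_mono) auto
      ultimately have "c * (gap * (m / 2) * Q y - e * m\<^sup>2) \<le> c * (K y * (P y + Q y - m) + gap * P y * Q y)"
        using c by (intro mult_left_mono) (auto simp: mult_ac)
      moreover have "c * (gap * (m / 2) * Q y) = p * Q y"
        using gap_pos m_ge by (simp add: c_def)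
      ultimately show "0 \<le> (2 + P y - p * Q y) + c * (K y * (P y + Q y - m) + gap * P y * Q y)"
        using e(3) P_nonneg[OF y0] right_diff_distrib[of c "gap * (m / 2) * Q y" "e * m\<^sup>2"] by linarith
    qed (use x in simp)
    have bound: "x - c * m\<^sup>2 \<le> ln (lam r)" if "x \<le> ln (lam y)" "L y \<le> L r" "0 < y" for x y
    proof -
      have "c * K r \<le> c * m\<^sup>2" using K_le[OF r] c by simp
      moreover have "0 \<le> c * K y" using K_nonneg[OF that(3)] c by simp
      ultimately show ?thesis using that(1,2) unfolding L_def by linarith
    qed
    have "l0 \<le> ln (lam r)"
    proof (rule last_entry[of 1 r P "m - e"])
      show "continuous_on {1..r} P"
        by (rule DERIV_continuous_on[where D = "\<lambda>x. ((P x)\<^sup>2 - m * P x + lam x) / x"])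
          (auto intro!: DERIV_subset[OF DP])
      assume "\<forall>x\<in>{1..r}. m - e \<le> P x"
      then have "ln (lam 1) - c * m\<^sup>2 \<le> ln (lam r)" using bound[of _ 1] incr[of 1] r1 by simp
      then show ?thesis by (simp add: l0_def)
    next
      fix t assume t: "1 \<le> t" "t < r" "P t = m - e" "\<forall>x\<in>{t..r}. m - e \<le> P x"
      then have t0: "0 < t" by simp
      \<comment> \<open>On entering the regime from below, \<open>P\<close> cannot be decreasing;
        its equation then gives \<open>lam t \<ge> P t * (m - P t) = (m - e) * e\<close>.\<close>
      have "0 \<le> ((P t)\<^sup>2 - m * P t + lam t) / t"
      proof (rule ccontr)
        assume "\<not> ?thesis"
        then obtain \<delta> where \<delta>: "0 < \<delta>" "\<And>h. 0 < h \<Longrightarrow> h < \<delta> \<Longrightarrow> P (t + h) < P t"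
          using DERIV_neg_dec_right[OF DP[OF t0]] by force
        define h where "h = min (\<delta> / 2) (r - t)"
        have "0 < h" "h < \<delta>" "t + h \<le> r" using \<delta>(1) t(2) by (auto simp: h_def min_def)
        moreover from this have "m - e \<le> P (t + h)" using t(4) by simp
        ultimately show False using \<delta>(2)[of h] t(3) by simp
      qed
      then have "0 \<le> (P t)\<^sup>2 - m * P t + lam t" using t0 by (simp add: zero_le_divide_iff)
      then have "e * (m - e) \<le> lam t" unfolding t(3) by (simp add: power2_eq_square algebra_simps)
      moreover have "e * (m / 2) \<le> e * (m - e)" using e by (intro mult_left_mono) auto
      ultimately have "e * (m / 2) \<le> lam t" by linarith
      moreover have "0 < e * (m / 2)" using e m_ge by simp
      ultimately have "ln (e * (m / 2)) \<le> ln (lam t)" by (intro ln_mono)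
      then have "ln (e * (m / 2)) - c * m\<^sup>2 \<le> ln (lam r)" using bound[of _ t] incr[of t] t by simp
      then show ?thesis by (simp add: l0_def)
    qed (use r1 False in auto)
    then have "exp l0 \<le> lam r" using lam_pos[OF r] by (simp add: ln_ge_iff)
    \<comment> \<open>The Harnack estimate turns the lower bound for \<open>lam\<close> into a
      distance of \<open>P\<close> from \<open>m\<close>.\<close>
    then have "2 powr (- m * p) * exp l0 \<le> 2 powr (- m * p) * lam r" by (intro mult_left_mono) auto
    then have "2 powr (- m * p) * exp l0 \<le> m - P r" using slope_gap[OF r] by linarith
    then show ?thesis by (simp add: d_def)
  qed
  then show ?thesis using d by blast
qed

end

section \<open>Lower bounds for the source ratios\<close>

context radial_lane_emden
begin

interpretation s: radial_lane_emden V U V' U' V0 U0 q p m by (rule swap)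

text \<open>As \<open>P\<close> and \<open>Q\<close> stay away from \<open>m\<close>, the damping in their equations lets \<open>ln lam - w Q\<close> grow as
  long as \<open>mu\<close> is small; the remaining term \<open>exp (ln lam - w Q)\<close> of the monotone quantity then pays
  for the possible decrease of \<open>ln mu - w' P\<close>.\<close>

lemma mu_bounded_below: "\<exists>c>0. \<forall>r\<ge>1. c \<le> mu r"
proof -
  obtain d where d: "0 < d" "\<And>r. 1 \<le> r \<Longrightarrow> P r \<le> m - d" using P_bounded_away by blast
  obtain d' where d': "0 < d'" "\<And>r. 1 \<le> r \<Longrightarrow> Q r \<le> m - d'" using s.P_bounded_away by blast
  \<comment> \<open>Because \<open>m - Q \<ge> d'\<close>, the damping
    \<open>w * Q * (m - Q)\<close> dominates \<open>p * Q\<close>. Hence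
    \<open>ln lam - w * Q\<close> has slope at least 1 in \<open>ln r\<close> as long as
    \<open>mu \<le> 1 / w\<close>; \<open>w'\<close> plays the same part for
    \<open>q * P\<close>.\<close>
  define w where "w = p / d'"
  define w' where "w' = q / d"
  have w: "0 < w" "0 < w'" using d d' p_pos q_pos by (auto simp: w_def w'_def)
  define l where "l x = ln (lam x) - w * Q x" for x
  define k where "k x = ln (mu x) - w' * P x" for x
  \<comment> \<open>From \<open>lam = exp (l + w * Q)\<close> and \<open>Q \<le> m\<close> follows
    \<open>w' * lam \<le> B * exp l\<close>. Since \<open>l\<close> grows at rate at least 1, the
    growth of \<open>B * exp l\<close> covers the loss \<open>w' * lam\<close> in the equation of
    \<open>k\<close>.\<close>
  define B where "B = w' * exp (w * m)"
  have B: "0 < B" using w by (simp add: B_def)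
  define F where "F x = k x + B * exp (l x)" for x
  define lmax where "lmax = m * 2 powr (m * p)"
  \<comment> \<open>The subtracted terms bound the difference between \<open>F\<close> and
    \<open>ln mu\<close>, since \<open>0 \<le> P \<le> m\<close> and
    \<open>exp l \<le> lam \<le> lmax\<close>.\<close>
  define k0 where "k0 = min (ln (mu 1)) (ln (1 / w)) - w' * m - B * lmax"
  define c where "c = min (1 / w) (exp k0)"
  have c: "0 < c" using w by (simp add: c_def)
  have "c \<le> mu r" if r1: "1 \<le> r" for r
  proof (cases "1 / w \<le> mu r")
    case True
    then show ?thesis by (simp add: c_def)
  next
    case False
    have r: "0 < r" using r1 by simp
    have incr: "F x \<le> F r" if x: "1 \<le> x" "x \<le> r" and ge: "\<forall>y\<in>{x..r}. - (1 / w) \<le> - mu y" for x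
    proof (rule nondecreasing_from_deriv[OF x(2)])
      fix y assume y: "y \<in> {x..r}"
      then have y1: "1 \<le> y" and y0: "0 < y" using x by auto
      define l1 where "l1 = (2 + P y - p * Q y) - w * ((Q y)\<^sup>2 - m * Q y + mu y)"
      define k1 where "k1 = (2 + Q y - q * P y) - w' * ((P y)\<^sup>2 - m * P y + lam y)"
      have Dl: "(l has_real_derivative l1 / y) (at y)"
        unfolding l_def l1_def
        by (rule DERIV_cong[OF DERIV_diff[OF Dln_lam[OF y0] DERIV_cmult[OF s.DP[OF y0], of w]]])
          (simp add: diff_divide_distrib)
      have Dk: "(k has_real_derivative k1 / y) (at y)"
        unfolding k_def k1_def
        by (rule DERIV_cong[OF DERIV_diff[OF s.Dln_lam[OF y0] DERIV_cmult[OF DP[OF y0], of w']]])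
          (simp add: diff_divide_distrib)
      show "(F has_real_derivative (k1 + B * (exp (l y) * l1)) / y) (at y)"
        unfolding F_def
        by (rule DERIV_cong[OF DERIV_add[OF Dk DERIV_cmult[OF DERIV_chain'[OF Dl DERIV_exp], of B]]])
          (simp add: add_divide_distrib)
      have "mu y * w \<le> 1" using ge y w by (force simp: pos_le_divide_eq)
      moreover have "w * (d' * Q y) \<le> w * ((m - Q y) * Q y)"
        using d'(2)[OF y1] s.P_nonneg[OF y0] w by (intro mult_left_mono mult_right_mono) auto
      moreover have "w * (d' * Q y) = p * Q y" using d' by (simp add: w_def)
      moreover have "l1 = 2 + P y - p * Q y + w * ((m - Q y) * Q y) - mu y * w"
        by (simp add: l1_def algebra_simps power2_eq_square)
      ultimately have l1: "1 \<le> l1" using P_nonneg[OF y0] by linarith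
      have "w' * (d * P y) \<le> w' * ((m - P y) * P y)"
        using d(2)[OF y1] P_nonneg[OF y0] w by (intro mult_left_mono mult_right_mono) auto
      moreover have "w' * (d * P y) = q * P y" using d by (simp add: w'_def)
      moreover have "k1 = 2 + Q y - q * P y + w' * ((m - P y) * P y) - w' * lam y"
        by (simp add: k1_def algebra_simps power2_eq_square)
      ultimately have k1: "2 - w' * lam y \<le> k1" using s.P_nonneg[OF y0] by linarith
      have "lam y = exp (l y + w * Q y)" using lam_pos[OF y0] by (simp add: l_def)
      also have "\<dots> \<le> exp (l y + w * m)" using s.P_le[OF y0] w by simp
      finally have "w' * lam y \<le> B * exp (l y)" using w by (simp add: B_def exp_add mult_ac)
      also have "\<dots> \<le> B * (exp (l y) * l1)" using l1 B by simp
      finally show "0 \<le> k1 + B * (exp (l y) * l1)" using k1 by linarith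
    qed (use x in simp)
    have bound: "x - w' * m - B * lmax \<le> ln (mu r)" if "x \<le> ln (mu y)" "F y \<le> F r" "0 < y" for x y
    proof -
      have "exp (l r) \<le> exp (ln (lam r))" unfolding l_def using w s.P_nonneg[OF r] by simp
      also have "\<dots> \<le> lmax" using lam_le[OF r] lam_pos[OF r] by (simp add: lmax_def)
      finally have "B * exp (l r) \<le> B * lmax" using B by simp
      moreover have "w' * P y \<le> w' * m" using P_le[OF that(3)] w by simp
      moreover have "0 \<le> w' * P r" using P_nonneg[OF r] w by simp
      moreover have "0 < B * exp (l y)" using B by simp
      ultimately show ?thesis using that(1,2) unfolding F_def k_def by linarith
    qed
    have "k0 \<le> ln (mu r)"
    \<comment> \<open>The sign is reversed because the regime is an upper bound on
      \<open>mu\<close>.\<close>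
    proof (rule last_entry[of 1 r "\<lambda>x. - mu x" "- (1 / w)"])
      have "continuous_on {1..r} mu"
        by (rule DERIV_continuous_on[where D = "\<lambda>x. mu x * (2 + Q x - q * P x) / x"])
          (auto intro!: DERIV_subset[OF s.Dlam])
      then show "continuous_on {1..r} (\<lambda>x. - mu x)" by (intro continuous_intros)
      assume "\<forall>x\<in>{1..r}. - (1 / w) \<le> - mu x"
      then have "ln (mu 1) - w' * m - B * lmax \<le> ln (mu r)" using bound[of _ 1] incr[of 1] r1 by simp
      then show ?thesis by (simp add: k0_def)
    next
      fix t assume t: "1 \<le> t" "t < r" "- mu t = - (1 / w)" "\<forall>x\<in>{t..r}. - (1 / w) \<le> - mu x"
      then have "ln (1 / w) - w' * m - B * lmax \<le> ln (mu r)" using bound[of "ln (1 / w)" t] incr[of t] by simp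
      then show ?thesis by (simp add: k0_def)
    qed (use r1 False in auto)
    then have "exp k0 \<le> mu r" using s.lam_pos[OF r] by (simp add: ln_ge_iff)
    then show ?thesis by (simp add: c_def)
  qed
  then show ?thesis using c by blast
qed

text \<open>The supercritical sum of reciprocals lies below \<open>m / (m + 2) < 1\<close>, and
  \<open>1 / (p + 1) + 1 / (q + 1) < 1\<close> is \<open>p * q > 1\<close> with denominators
  cleared.\<close>

lemma pq_gt_1: "1 < p * q"
proof -
  have "1 / (p + 1) + 1 / (q + 1) < 1"
  proof -
    have "(m + 2) * (1 / (p + 1) + 1 / (q + 1)) < (m + 2) * 1"
      using supercritical by (simp add: distrib_left)
    then show ?thesis using m_ge by (subst (asm) mult_less_cancel_left_pos) auto
  qed
  moreover have "1 / (p + 1) + 1 / (q + 1) = (p + q + 2) / ((p + 1) * (q + 1))"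
    using p_pos q_pos by (simp add: add_frac_eq)
  ultimately have "p + q + 2 < (p + 1) * (q + 1)" using p_pos q_pos by (simp add: pos_divide_less_eq)
  then show ?thesis by (simp add: algebra_simps)
qed

end

section \<open>Two-sided power bounds\<close>

context radial_lane_emden
begin

interpretation s: radial_lane_emden V U V' U' V0 U0 q p m by (rule swap)

lemma U_two_sided:
  "\<exists>c>0. \<exists>C>0. \<forall>r\<ge>1. c * r powr (- (2 * (p + 1) / (p * q - 1))) \<le> U r \<and>
     U r \<le> C * r powr (- (2 * (p + 1) / (p * q - 1)))"
proof -
  obtain a where a: "0 < a" "\<And>r. 1 \<le> r \<Longrightarrow> a \<le> lam r" using s.mu_bounded_below by blast
  obtain b where b: "0 < b" "\<And>r. 1 \<le> r \<Longrightarrow> b \<le> mu r" using mu_bounded_below by blast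
  define A where "A = m * 2 powr (m * p)"
  define B where "B = m * 2 powr (m * q)"
  have AB: "0 < A" "0 < B" using m_ge by (auto simp: A_def B_def)
  define g where "g = p * q - 1"
  have g: "0 < g" using pq_gt_1 by (simp add: g_def)
  have eq: "U r = (lam r * mu r powr p) powr (1 / g) * r powr (- (2 * (p + 1) / g))" if r: "0 < r" for r
  proof -
    \<comment> \<open>The powers of \<open>V\<close> cancel in this product, so it can be solved for
      \<open>U\<close>.\<close>
    have "ln (lam r * mu r powr p) = (2 + 2 * p) * ln r + g * ln (U r)"
      using r U_pos[OF r] V_pos[OF r]
      by (simp add: source_ratio_def ln_mult ln_div ln_powr ln_realpow g_def algebra_simps)
    moreover have "0 < lam r * mu r powr p" using lam_pos[OF r] s.lam_pos[OF r] by simp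
    moreover have "x powr (1 / g) = exp (ln x / g)" if "0 < x" for x :: real using that by (simp add: powr_def)
    ultimately have "(lam r * mu r powr p) powr (1 / g) = exp (((2 + 2 * p) * ln r + g * ln (U r)) / g)"
      by metis
    moreover have "r powr (- (2 * (p + 1) / g)) = exp (- (2 * (p + 1) / g) * ln r)"
      using r by (simp add: powr_def)
    moreover have "((2 + 2 * p) * ln r + g * ln (U r)) / g + - (2 * (p + 1) / g) * ln r = ln (U r)"
      using g by (simp add: field_simps)
    ultimately show ?thesis using U_pos[OF r] by (simp flip: exp_add)
  qed
  have "(a * b powr p) powr (1 / g) * r powr (- (2 * (p + 1) / g)) \<le> U r \<and>
        U r \<le> (A * B powr p) powr (1 / g) * r powr (- (2 * (p + 1) / g))" if r1: "1 \<le> r" for r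
  proof -
    have r: "0 < r" using r1 by simp
    have "(a * b powr p) powr (1 / g) \<le> (lam r * mu r powr p) powr (1 / g)"
      using a b r1 g p_pos by (intro powr_mono2 mult_mono) (auto intro: order.trans[OF less_imp_le])
    moreover have "(lam r * mu r powr p) powr (1 / g) \<le> (A * B powr p) powr (1 / g)"
      using AB g p_pos lam_pos[OF r] s.lam_pos[OF r] lam_le[OF r] s.lam_le[OF r]
      by (intro powr_mono2 mult_mono) (auto simp: A_def B_def)
    ultimately show ?thesis unfolding eq[OF r] by (auto intro: mult_right_mono)
  qed
  moreover have "0 < (a * b powr p) powr (1 / g)" "0 < (A * B powr p) powr (1 / g)" using a b AB by auto
  ultimately show ?thesis unfolding g_def by blast
qed

end

subsection \<open>Profiles of radial solutions\<close>

lemma locally_bounded_ray: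
  assumes "locally_bounded u" "norm e = 1"
  shows "locally_bounded (\<lambda>r. u (r *\<^sub>R e))"
  unfolding locally_bounded_real_iff
proof
  fix B :: real
  have "bounded (u ` cball 0 B)" using assms(1) by (simp add: locally_bounded_def)
  then obtain M where "\<forall>x\<in>cball 0 B. \<bar>u x\<bar> \<le> M" by (auto simp: bounded_iff)
  then show "\<exists>M. \<forall>t. \<bar>t\<bar> \<le> B \<longrightarrow> \<bar>u (t *\<^sub>R e)\<bar> \<le> M"
    using assms(2) by (intro exI[of _ M]) simp
qed

lemma locally_bounded_powr:
  fixes f :: "real \<Rightarrow> real"
  assumes f: "locally_bounded f" and "\<And>t. 0 \<le> f t" "0 \<le> p"
  shows "locally_bounded (\<lambda>t. f t powr p)"
  unfolding locally_bounded_real_iff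
proof
  fix B
  obtain M where "0 \<le> M" "\<And>t. \<bar>t\<bar> \<le> B \<Longrightarrow> \<bar>f t\<bar> \<le> M" using locally_boundedE[OF f] by blast
  then show "\<exists>M. \<forall>t. \<bar>t\<bar> \<le> B \<longrightarrow> \<bar>f t powr p\<bar> \<le> M"
    using assms(2,3) by (intro exI[of _ "M powr p"]) (auto intro!: powr_mono2)
qed

text \<open>A negative value at \<open>r\<close> would persist on an interval to the right of
  \<open>r\<close>, which has positive measure. Only the right side is used, so the argument covers
  \<open>r = 0\<close> as well.\<close>

lemma nonneg_of_AE_nonneg:
  assumes U: "continuous_on UNIV U" and ae: "AE r in lborel. 0 < r \<longrightarrow> 0 \<le> U r" and r: "0 \<le> (r::real)"
  shows "0 \<le> (U r :: real)"
proof (rule ccontr)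
  assume "\<not> ?thesis"
  then have neg: "U r < 0" by simp
  have "open {s. U s < 0}" using U by (intro open_Collect_less continuous_intros)
  then obtain d where d: "0 < d" "ball r d \<subseteq> {s. U s < 0}" using neg open_contains_ball by blast
  have "AE s in lborel. s \<notin> {r<..<r + d}"
    using ae
  proof eventually_elim
    case (elim s)
    show ?case
    proof
      assume s: "s \<in> {r<..<r + d}"
      then have "s \<in> ball r d" by (auto simp: dist_real_def)
      then show False using d elim s r by force
    qed
  qed
  then have "{r<..<r + d} \<in> null_sets lborel" by (subst AE_iff_null_sets) auto
  then show False using d by (simp add: null_sets_def)
qed

text \<open>Allows the sources to be rewritten with the continuous representatives, so that
  equations known almost everywhere close up into a pointwise system.\<close>

lemma flux_cong_AE:
  assumes "AE t in lborel. 0 < t \<longrightarrow> F t = G t"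
  shows "flux n F = flux n G"
proof
  fix r
  obtain N where N: "N \<in> null_sets lborel" "{t. \<not> (0 < t \<longrightarrow> F t = G t)} \<subseteq> N"
    using assms unfolding eventually_ae_filter by auto
  have "negligible (insert 0 N)"
    using N(1) by (simp add: negligible_iff_null_sets null_sets_completionI)
  then show "flux n F r = flux n G r" unfolding flux_def
  proof (rule integral_spike)
    fix t assume "t \<in> {0..r} - insert 0 N"
    then have "0 < t" "t \<notin> N" by auto
    then show "G t * t ^ (n - 1) = F t * t ^ (n - 1)" using N(2) by auto
  qed
qed

lemma decrement_cong_AE:
  assumes "AE t in lborel. 0 < t \<longrightarrow> F t = G t"
  shows "decrement n F = decrement n G"
  using flux_cong_AE[OF assms] by (simp add: decrement_def[abs_def] slope_def[abs_def])

text \<open>One equation of the system in integrated form; it is instantiated twice with the two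
  profiles exchanged.\<close>

locale radial_potential =
  fixes n :: nat and p c :: real and U V :: "real \<Rightarrow> real"
  assumes p: "0 < p" and V_cont: "continuous_on UNIV V" and V_nonneg: "\<And>r. 0 \<le> V r"
    and U_eq: "\<And>r. U r = c - decrement n (\<lambda>t. V t powr p) r" and U_nonneg: "\<And>r. 0 \<le> U r"
    and n: "1 \<le> n"
begin

abbreviation "U' \<equiv> \<lambda>r. - slope n (\<lambda>t. V t powr p) r"

lemma source_cont: "continuous_on UNIV (\<lambda>t. V t powr p)"
  using p V_nonneg by (intro continuous_on_powr' V_cont continuous_intros) auto

lemma source_regular: "(\<lambda>t. V t powr p) \<in> borel_measurable borel" "locally_bounded (\<lambda>t. V t powr p)"
  by (rule borel_measurable_continuous_onI[OF source_cont], rule locally_bounded_continuous[OF source_cont])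

lemma DERIV_U: "(U has_real_derivative U' r) (at r)"
  using DERIV_diff[OF DERIV_const[of c] DERIV_decrement[OF source_regular, of n r]]
  by (simp add: U_eq[abs_def])

lemma weighted_cont: "continuous_on UNIV (\<lambda>t. V t powr p * t ^ (n - 1))"
  by (intro continuous_on_mult source_cont continuous_on_power continuous_on_id)

lemma DERIV_flux:
  assumes "0 < r"
  shows "(flux n (\<lambda>t. V t powr p) has_real_derivative V r powr p * r ^ (n - 1)) (at r)"
proof -
  have "(flux n (\<lambda>t. V t powr p) has_real_derivative V r powr p * r ^ (n - 1)) (at r within {0..r + 1})"
    unfolding flux_def
    by (rule integral_has_real_derivative, rule continuous_on_subset[OF weighted_cont]) (use assms in auto)
  then show ?thesis using assms by (subst (asm) at_within_interior) auto
qed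

lemma DERIV_U':
  assumes r: "0 < r"
  shows "(U' has_real_derivative - (V r powr p) - (real n - 1) / r * U' r) (at r)"
proof -
  have "((\<lambda>r. r ^ (n - 1)) has_real_derivative real (n - 1) * r ^ (n - 1 - 1)) (at r)"
    by (auto intro!: derivative_eq_intros)
  \<comment> \<open>The case split covers \<open>n = 1\<close>, where the exponent is truncated at 0
    but the factor \<open>n - 1\<close> vanishes.\<close>
  moreover have "real (n - 1) * r ^ (n - 1 - 1) = (real n - 1) * r ^ (n - 1) / r"
    using r n by (cases "n - 1") (auto simp: of_nat_diff)
  ultimately have pw: "((\<lambda>r. r ^ (n - 1)) has_real_derivative (real n - 1) * r ^ (n - 1) / r) (at r)" by simp
  show ?thesis unfolding slope_def
    by (rule DERIV_cong[OF DERIV_minus[OF DERIV_divide[OF DERIV_flux[OF r] pw]]])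
      (use r in \<open>auto simp: field_simps\<close>)
qed

lemma flux_nonneg: "0 \<le> flux n (\<lambda>t. V t powr p) r"
  unfolding flux_def
  by (intro Henstock_Kurzweil_Integration.integral_nonneg integrable_continuous_interval
      continuous_on_subset[OF weighted_cont]) auto

lemma U'_nonpos: "0 \<le> r \<Longrightarrow> U' r \<le> 0"
  using flux_nonneg by (simp add: slope_def)

lemma U'_tendsto: "(U' \<longlongrightarrow> 0) (at_right 0)"
proof -
  have "isCont U' 0"
    using continuous_slope[OF source_regular] by (intro continuous_intros) (simp add: continuous_on_eq_continuous_at)
  then have "(U' \<longlongrightarrow> U' 0) (at_right 0)"
    unfolding isCont_def by (rule filterlim_mono) (auto simp: at_le)
  then show ?thesis by (simp add: slope_def flux_nonpos_arg)
qed

lemma U_tendsto: "(U \<longlongrightarrow> U 0) (at_right 0)"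
  using DERIV_isCont[OF DERIV_U, of 0] unfolding isCont_def by (rule filterlim_mono) (auto simp: at_le)

lemma U_antimono:
  assumes "0 \<le> r" "r \<le> t"
  shows "U t \<le> U r"
  by (rule DERIV_nonpos_imp_nonincreasing[OF assms(2)]) (use assms(1) DERIV_U U'_nonpos in force)

text \<open>Positivity of \<open>V\<close> near 0 makes the flux positive at every positive radius,
  whatever \<open>V\<close> does further out. So \<open>U\<close> decreases strictly, and a
  nonnegative function that still decreases beyond \<open>r\<close> is positive at
  \<open>r\<close>.\<close>

lemma U_pos:
  assumes V0: "0 < V 0" and r: "0 < r"
  shows "0 < U r"
proof -
  have slope_pos: "0 < slope n (\<lambda>t. V t powr p) s" if s: "0 < s" for s
  proof -
    have "open {t. 0 < V t}" using V_cont by (intro open_Collect_less continuous_intros)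
    then obtain d where d: "0 < d" "ball 0 d \<subseteq> {t. 0 < V t}" using V0 open_contains_ball by blast
    define t where "t = min s (d / 2)"
    have t: "t \<in> {0..s}" "0 < t" "t \<in> ball 0 d" using d(1) s by (auto simp: t_def dist_real_def)
    then have Vt: "0 < V t" using d(2) by blast
    have "flux n (\<lambda>t. V t powr p) s \<noteq> 0"
    proof
      assume "flux n (\<lambda>t. V t powr p) s = 0"
      then have "\<forall>t\<in>{0..s}. V t powr p * t ^ (n - 1) = 0"
        unfolding flux_def
        by (subst (asm) integral_eq_0_iff[OF continuous_on_subset[OF weighted_cont subset_UNIV] s]) auto
      then have "V t powr p * t ^ (n - 1) = 0" using t(1) by blast
      then show False using t(2) Vt by simp
    qed
    then show ?thesis using flux_nonneg[of s] s by (simp add: slope_def)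
  qed
  have "U (r + 1) < U r"
  proof (rule DERIV_neg_imp_decreasing[of r "r + 1" U])
    fix x assume "r \<le> x" "x \<le> r + 1"
    then show "\<exists>y. DERIV U x :> y \<and> y < 0" using DERIV_U[of x] slope_pos[of x] r by (intro exI[of _ "U' x"]) auto
  qed simp
  then show ?thesis using U_nonneg[of "r + 1"] by linarith
qed

end

theorem theorem4p4:
  fixes u v :: "real ^ 'n \<Rightarrow> real" and p q :: real
  assumes "0 < p" and "0 < q"
    and "1 / (p + 1) + 1 / (q + 1) < 1 - 2 / real CARD('n)"
    and "radial u" and "radial v"
    and "locally_bounded_lane_emden_solution p q u v"
  shows "\<exists>U V. radial_profile u U \<and> radial_profile v V \<and>
    ((\<forall>r\<ge>0. U r = 0 \<and> V r = 0) \<or>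
     (\<exists>C1>0. \<exists>C2>0. \<exists>r0>0. \<forall>r\<ge>r0.
        C1 * r powr (- (2 * (p + 1) / (p * q - 1))) \<le> U r \<and>
        U r \<le> C2 * r powr (- (2 * (p + 1) / (p * q - 1))) \<and>
        C1 * r powr (- (2 * (q + 1) / (p * q - 1))) \<le> V r \<and>
        V r \<le> C2 * r powr (- (2 * (q + 1) / (p * q - 1)))))"
proof -
  define n where "n = CARD('n)"
  have dim: "DIM(real ^ 'n) = n" by (simp add: n_def)
  have n1: "1 \<le> n" by (simp add: n_def Suc_leI)
  obtain e :: "real ^ 'n" where "e \<in> Basis" using nonempty_Basis by blast
  then have e: "norm e = 1" by simp
  have u: "u \<in> borel_measurable borel" "v \<in> borel_measurable borel" "locally_bounded u" "locally_bounded v"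
    "\<And>x. 0 \<le> u x" "\<And>x. 0 \<le> v x" and eqs: "neg_laplacian_eq u (\<lambda>x. v x powr p)" "neg_laplacian_eq v (\<lambda>x. u x powr q)"
    using assms(6) by (auto simp: locally_bounded_lane_emden_solution_def)
  define W1 where "W1 r = u (r *\<^sub>R e)" for r
  define W2 where "W2 r = v (r *\<^sub>R e)" for r
  have W: "u x = W1 (norm x)" "v x = W2 (norm x)" for x
  proof -
    have "norm x = norm (norm x *\<^sub>R e)" using e by simp
    then show "u x = W1 (norm x)" "v x = W2 (norm x)"
      using assms(4,5) unfolding radial_def W1_def W2_def by blast+
  qed
  have [measurable]: "W1 \<in> borel_measurable borel" "W2 \<in> borel_measurable borel"
    unfolding W1_def[abs_def] W2_def[abs_def] using u(1,2) by measurable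
  have Wb: "locally_bounded W1" "locally_bounded W2"
    unfolding W1_def[abs_def] W2_def[abs_def] using u e by (auto intro: locally_bounded_ray)
  have W0: "0 \<le> W1 r" "0 \<le> W2 r" for r using u by (auto simp: W1_def W2_def)
  have Sb: "locally_bounded (\<lambda>t. W2 t powr p)" "locally_bounded (\<lambda>t. W1 t powr q)"
    using Wb W0 assms(1,2) by (auto intro: locally_bounded_powr)
  obtain c1 where c1: "AE r in lborel. 0 < r \<longrightarrow> W1 r = c1 - decrement n (\<lambda>t. W2 t powr p) r"
    unfolding dim[symmetric]
    by (rule radial_representation[OF eqs(1), of W1 "\<lambda>t. W2 t powr p"]) (use W Wb Sb in auto)
  obtain c2 where c2: "AE r in lborel. 0 < r \<longrightarrow> W2 r = c2 - decrement n (\<lambda>t. W1 t powr q) r"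
    unfolding dim[symmetric]
    by (rule radial_representation[OF eqs(2), of W2 "\<lambda>t. W1 t powr q"]) (use W Wb Sb in auto)
  \<comment> \<open>The continuous representative; it agrees with \<open>W1\<close> only almost
    everywhere, so the source still contains the original \<open>W2\<close>.\<close>
  define U where "U r = c1 - decrement n (\<lambda>t. W2 t powr p) r" for r
  define V where "V r = c2 - decrement n (\<lambda>t. W1 t powr q) r" for r
  have contU: "continuous_on UNIV U" "continuous_on UNIV V"
    unfolding U_def[abs_def] V_def[abs_def]
    by (intro continuous_intros continuous_decrement Sb; measurable)+
  then have [measurable]: "U \<in> borel_measurable borel" "V \<in> borel_measurable borel"
    by (auto intro: borel_measurable_continuous_onI)
  have ae: "AE r in lborel. 0 < r \<longrightarrow> W1 r = U r" "AE r in lborel. 0 < r \<longrightarrow> W2 r = V r"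
    using c1 c2 by (simp_all add: U_def V_def)
  have nonneg: "0 \<le> U r" "0 \<le> V r" if "0 \<le> r" for r
  proof -
    have "AE r in lborel. 0 < r \<longrightarrow> 0 \<le> U r" using ae(1) by eventually_elim (metis W0(1))
    then show "0 \<le> U r" by (intro nonneg_of_AE_nonneg[OF contU(1) _ that])
    have "AE r in lborel. 0 < r \<longrightarrow> 0 \<le> V r" using ae(2) by eventually_elim (metis W0(2))
    then show "0 \<le> V r" by (intro nonneg_of_AE_nonneg[OF contU(2) _ that])
  qed
  have nonneg': "0 \<le> U r" "0 \<le> V r" for r
  proof -
    \<comment> \<open>Integrals over empty intervals vanish, which extends nonnegativity to the
      whole line as the locale requires.\<close>
    have "U r = U 0" "V r = V 0" if "r \<le> 0"
      using that by (cases "r = 0"; simp add: U_def V_def decrement_def)+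
    then show "0 \<le> U r" "0 \<le> V r" using nonneg[of r] nonneg[of 0] by (cases "0 \<le> r"; simp)+
  qed
  have profile: "radial_profile u U" "radial_profile v V"
  proof -
    have "AE x::real ^ 'n in lborel. W1 (norm x) = U (norm x)" by (rule AE_radial[OF ae(1)]) measurable
    moreover have "AE x::real ^ 'n in lborel. W2 (norm x) = V (norm x)" by (rule AE_radial[OF ae(2)]) measurable
    ultimately show "radial_profile u U" "radial_profile v V"
      using contU unfolding radial_profile_def W by (auto intro: continuous_on_subset)
  qed
  have pot1: "decrement n (\<lambda>t. W2 t powr p) = decrement n (\<lambda>t. V t powr p)"
    by (rule decrement_cong_AE) (use ae(2) in \<open>auto elim!: eventually_mono\<close>)
  have pot2: "decrement n (\<lambda>t. W1 t powr q) = decrement n (\<lambda>t. U t powr q)"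
    by (rule decrement_cong_AE) (use ae(1) in \<open>auto elim!: eventually_mono\<close>)
  interpret u: radial_potential n p c1 U V
    by unfold_locales (use assms(1) contU nonneg' n1 in \<open>auto simp: U_def pot1\<close>)
  interpret v: radial_potential n q c2 V U
    by unfold_locales (use assms(2) contU nonneg' n1 in \<open>auto simp: V_def pot2\<close>)
  show ?thesis
  proof (cases "U 0 = 0 \<and> V 0 = 0")
    case True
    then have "U r = 0 \<and> V r = 0" if "0 \<le> r" for r
      using u.U_antimono[of 0 r] v.U_antimono[of 0 r] nonneg'[of r] that by auto
    then show ?thesis using profile by blast
  next
    case False
    \<comment> \<open>Positivity passes back and forth: if one profile is positive at 0, the other
      is positive at 1, hence at 0 by monotonicity, and then both are positive at every positive
      radius.\<close>
    have pos: "0 < U r \<and> 0 < V r" if r: "0 < r" for r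
    proof (cases "0 < V 0")
      case True
      then have "0 < U 1" by (intro u.U_pos) auto
      then have "0 < U 0" using u.U_antimono[of 0 1] by auto
      then show ?thesis using u.U_pos[OF True r] v.U_pos[OF _ r] by auto
    next
      case False
      then have U0: "0 < U 0" using \<open>\<not> (U 0 = 0 \<and> V 0 = 0)\<close> nonneg'[of 0] by auto
      then have "0 < V 1" by (intro v.U_pos) auto
      then have "0 < V 0" using v.U_antimono[of 0 1] by auto
      then show ?thesis using u.U_pos[OF _ r] v.U_pos[OF U0 r] by auto
    qed
    have "0 < 1 / (p + 1) + 1 / (q + 1)" using assms(1,2) by (intro add_pos_pos divide_pos_pos) auto
    then have "2 / real n < 1" using assms(3) unfolding n_def by linarith
    then have "2 < real n" using n1 by (simp add: divide_less_eq)
    \<comment> \<open>Supercriticality forces \<open>n > 2\<close>, and integrality upgrades this to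
      the bound \<open>m \<ge> 1\<close> of the locale.\<close>
    then have "3 \<le> n" by simp
    then have n3: "1 \<le> real n - 2" using of_nat_mono[of 3 n, where 'a = real] by simp
    define m where "m = real n - 2"
    have crit: "(m + 2) / (p + 1) + (m + 2) / (q + 1) < m"
    proof -
      have "real n * (1 / (p + 1) + 1 / (q + 1)) < real n * (1 - 2 / real n)"
        using assms(3) n1 by (intro mult_strict_left_mono) (auto simp: n_def)
      then show ?thesis using n1 by (simp add: m_def distrib_left right_diff_distrib)
    qed
    interpret e: radial_lane_emden U V u.U' v.U' "U 0" "V 0" p q m
    proof
      show "(u.U' has_real_derivative - (V r powr p) - (m + 1) / r * u.U' r) (at r)" if "0 < r" for r
        using u.DERIV_U'[OF that] by (simp add: m_def)
      show "(v.U' has_real_derivative - (U r powr q) - (m + 1) / r * v.U' r) (at r)" if "0 < r" for r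
        using v.DERIV_U'[OF that] by (simp add: m_def)
      show "1 \<le> m" using n3 by (simp add: m_def)
    qed (use assms(1,2) crit pos u.U'_nonpos v.U'_nonpos u.DERIV_U v.DERIV_U
        u.U_tendsto v.U_tendsto u.U'_tendsto v.U'_tendsto in auto)
    interpret e': radial_lane_emden V U v.U' u.U' "V 0" "U 0" q p m by (rule e.swap)
    define \<alpha> where "\<alpha> = - (2 * (p + 1) / (p * q - 1))"
    define \<beta> where "\<beta> = - (2 * (q + 1) / (p * q - 1))"
    obtain a A where a: "0 < a" "0 < A" "\<And>r. 1 \<le> r \<Longrightarrow> a * r powr \<alpha> \<le> U r \<and> U r \<le> A * r powr \<alpha>"
      using e.U_two_sided unfolding \<alpha>_def by blast
    obtain b B where b: "0 < b" "0 < B" "\<And>r. 1 \<le> r \<Longrightarrow> b * r powr \<beta> \<le> V r \<and> V r \<le> B * r powr \<beta>"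
      using e'.U_two_sided unfolding \<beta>_def mult.commute[of q p] by blast
    \<comment> \<open>A common pair of constants has to serve both profiles.\<close>
    have "min a b * r powr \<alpha> \<le> U r \<and> U r \<le> max A B * r powr \<alpha> \<and> min a b * r powr \<beta> \<le> V r \<and> V r \<le> max A B * r powr \<beta>"
      if "1 \<le> r" for r
    proof -
      have "min a b * x \<le> a * x" "min a b * x \<le> b * x" "A * x \<le> max A B * x" "B * x \<le> max A B * x"
        if "0 \<le> x" for x using that by (auto intro: mult_right_mono)
      then show ?thesis using a(3)[OF that] b(3)[OF that] by (meson order.trans powr_ge_zero)
    qed
    moreover have "0 < min a b" "0 < max A B" using a b by auto
    ultimately show ?thesis using profile zero_less_one unfolding \<alpha>_def \<beta>_def by blast
  qed
qed

end
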